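(* Let $n=2$ be the number of experts, and consider either the site prediction model or the coordinator prediction model, with $k$ sites and time horizon $T$, in the case of an adaptive adversary. Then any (distributed) algorithm that achieves expected regret $o(\sqrt{kT})$ must use communication $(T/k)(1-o(1))$.
   Context: A distributed system consists of one coordinator node connected to $k$ site nodes; sites communicate with each other only via the coordinator. There are $n$ experts and a time horizon $T$. Site prediction model: at each time step $t=1,\dots,T$ one site $s^t$ receives a query and must pick an expert $a^t\in[n]=\{1,\dots,n\}$; then the payoff vector $\mathbf p^t\in[0,1]^n$ is revealed only to the site $s^t$, and the system receives payoff $\mathbf p^t[a^t]$. Coordinator prediction model: at each time step $t$ the coordinator receives the query and must pick an expert $a^t\in[n]$; at the end of the round one site $s^t$ observes the payoff vector $\mathbf p^t\in[0,1]^n$, and the system receives payoff $\mathbf p^t[a^t]$. In both models the adversary chooses the payoff vectors $\mathbf p^t$ and the sites $s^t$. An adaptive adversary knows the description of the algorithm, can record all past actions of the algorithm, and can use these arbitrarily to decide the future payoff vectors and site allocations. The algorithm may be randomized, both in picking experts and in deciding when to communicate. Expected regret is $\mathbb E\big[\max_{a\in[n]}\sum_{t=1}^T\mathbf p^t[a]-\sum_{t=1}^T\mathbf p^t[a^t]\big]$. Communication is measured by the (expected) number of messages sent in the system. Communication delay is zero: messages are received before any later query arrives. The result is a lower bound on communication, with asymptotics in terms of $k$ and $T$.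
   Formalization: The formal theorem adds k ≤ T (with T tending to infinity), since for T = o(k) a silent algorithm has regret at most T = o(√(kT)) and communication 0; nodes use private discrete randomness and boundedly many message slots per round. *)

theory Defs
  imports "HOL-Probability.Probability" "HOL-Library.Landau_Symbols"
begin

datatype prediction_model = Site_Prediction | Coordinator_Prediction

datatype node = Coordinator | Site nat

(* A run is the chronological list of its events.
   Slot u w m is an opportunity for u to send one message to w: m = Some x means that the
   message x is sent, m = None that u stays silent.
   Reveal s p: site s observes the payoff vector p (payoff p $ a for expert a). *)
datatype ('n, 'm) event =
    Query node
  | Slot node node "'m option"
  | Pick node 'n
  | Reveal nat "real ^ 'n"

type_synonym ('n, 'm) history = "('n, 'm) event list"

fun sees :: "node \<Rightarrow> ('n::finite, 'm) event \<Rightarrow> bool" where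
  "sees v (Query u) \<longleftrightarrow> v = u"
| "sees v (Slot u w m) \<longleftrightarrow> v = u \<or> v = w"
| "sees v (Pick u a) \<longleftrightarrow> v = u"
| "sees v (Reveal s p) \<longleftrightarrow> v = Site s"

(* Events that a node does not see are replaced by None rather than dropped, so all nodes share
   a global clock, and absence of a message in a slot is noticed at both ends of the link. *)
definition view :: "node \<Rightarrow> ('n::finite, 'm) history \<Rightarrow> ('n, 'm) event option list" where
  "view v h = map (\<lambda>e. if sees v e then Some e else None) h"

(* Distributed algorithms. Every decision of a node is randomized with fresh local randomness
   and depends only on that node's view. As the view contains all earlier observations and
   actions of the node, private coins drawn in advance by each node give nothing more general
   (Kuhn's theorem). The number of slots per communication phase is an arbitrary parameter of
   the algorithm, so any bounded number of exchanges may take place between two queries. *)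
record ('n, 'm) algorithm =
  sub_rounds :: nat
  send :: "node \<Rightarrow> node \<Rightarrow> ('n, 'm) event option list \<Rightarrow> 'm option pmf"
  predict :: "node \<Rightarrow> ('n, 'm) event option list \<Rightarrow> 'n pmf"

(* Adaptive adversaries: their choices depend on the complete history, including all picks and
   the contents of all messages so far. The second argument of choose_payoff is the site
   of the current round. *)
record ('n, 'm) adversary =
  choose_site :: "('n, 'm) history \<Rightarrow> nat pmf"
  choose_payoff :: "('n, 'm) history \<Rightarrow> nat \<Rightarrow> (real ^ 'n) pmf"

definition adversaries :: "nat \<Rightarrow> ('n::finite, 'm) adversary set" where
  "adversaries k = {B. \<forall>h. set_pmf (choose_site B h) \<subseteq> {..<k} \<and>
     (\<forall>s. set_pmf (choose_payoff B h s) \<subseteq> {p. \<forall>a. 0 \<le> p $ a \<and> p $ a \<le> 1})}"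

definition links :: "nat \<Rightarrow> (node \<times> node) list" where
  "links k = map (\<lambda>i. (Site i, Coordinator)) [0..<k] @ map (\<lambda>i. (Coordinator, Site i)) [0..<k]"

fun run_slots :: "('n::finite, 'm) algorithm \<Rightarrow> (node \<times> node) list \<Rightarrow> ('n, 'm) history \<Rightarrow>
    ('n, 'm) history pmf" where
  "run_slots A [] h = return_pmf h"
| "run_slots A ((u, w) # ls) h = do {
     m \<leftarrow> send A u w (view u h);
     run_slots A ls (h @ [Slot u w m])
   }"

definition communicate :: "('n::finite, 'm) algorithm \<Rightarrow> nat \<Rightarrow> ('n, 'm) history \<Rightarrow>
    ('n, 'm) history pmf" where
  "communicate A k h = run_slots A (concat (replicate (sub_rounds A) (links k))) h"

(* One round. Nodes can communicate both on arrival of the query and after the payoffs have been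
   observed. The payoff vector is chosen after the messages that precede the prediction, but
   independently of the current pick. *)
fun play_round :: "prediction_model \<Rightarrow> ('n::finite, 'm) algorithm \<Rightarrow> ('n, 'm) adversary \<Rightarrow> nat \<Rightarrow>
    ('n, 'm) history \<Rightarrow> ('n, 'm) history pmf" where
  "play_round Site_Prediction A B k h = do {
     s \<leftarrow> choose_site B h;
     h' \<leftarrow> communicate A k (h @ [Query (Site s)]);
     a \<leftarrow> predict A (Site s) (view (Site s) h');
     p \<leftarrow> choose_payoff B h' s;
     communicate A k (h' @ [Pick (Site s) a, Reveal s p])
   }"
| "play_round Coordinator_Prediction A B k h = do {
     h' \<leftarrow> communicate A k (h @ [Query Coordinator]);
     a \<leftarrow> predict A Coordinator (view Coordinator h');
     s \<leftarrow> choose_site B h';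
     p \<leftarrow> choose_payoff B h' s;
     communicate A k (h' @ [Pick Coordinator a, Reveal s p])
   }"

fun play :: "prediction_model \<Rightarrow> ('n::finite, 'm) algorithm \<Rightarrow> ('n, 'm) adversary \<Rightarrow> nat \<Rightarrow> nat \<Rightarrow>
    ('n, 'm) history pmf" where
  "play M A B k 0 = return_pmf []"
| "play M A B k (Suc t) = do { h \<leftarrow> play M A B k t; play_round M A B k h }"

definition picks :: "('n::finite, 'm) history \<Rightarrow> 'n list" where
  "picks h = concat (map (\<lambda>e. case e of Pick u a \<Rightarrow> [a] | _ \<Rightarrow> []) h)"

definition payoffs :: "('n::finite, 'm) history \<Rightarrow> (real ^ 'n) list" where
  "payoffs h = concat (map (\<lambda>e. case e of Reveal s p \<Rightarrow> [p] | _ \<Rightarrow> []) h)"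

definition regret :: "('n::finite, 'm) history \<Rightarrow> real" where
  "regret h = Max (range (\<lambda>a. \<Sum>p\<leftarrow>payoffs h. p $ a))
     - (\<Sum>(p, a)\<leftarrow>zip (payoffs h) (picks h). p $ a)"

fun is_message :: "('n::finite, 'm) event \<Rightarrow> bool" where
  "is_message (Slot u w m) \<longleftrightarrow> m \<noteq> None"
| "is_message _ \<longleftrightarrow> False"

definition message_count :: "('n::finite, 'm) history \<Rightarrow> nat" where
  "message_count h = length (filter is_message h)"

(* Both suprema are over nonempty bounded sets if k > 0: on the runs that occur, the regret is
   at most T in absolute value, and the number of messages at most 4 * T * k * sub_rounds A. *)
definition expected_regret ::
    "prediction_model \<Rightarrow> nat \<Rightarrow> nat \<Rightarrow> ('n::finite, 'm) algorithm \<Rightarrow> real" where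
  "expected_regret M k T A =
     (SUP B\<in>adversaries k. measure_pmf.expectation (play M A B k T) regret)"

definition expected_communication ::
    "prediction_model \<Rightarrow> nat \<Rightarrow> nat \<Rightarrow> ('n::finite, 'm) algorithm \<Rightarrow> real" where
  "expected_communication M k T A =
     (SUP B\<in>adversaries k. measure_pmf.expectation (play M A B k T) (\<lambda>h. real (message_count h)))"

end

theory Submission
  imports Defs
begin

text \<open>
Time is cut into phases of length proportional to \<open>k\<close>. In a phase each query concerns a fresh site, and the
opponent pays 1 to the same uniformly chosen expert in each round until somebody speaks; from then on
it pays nothing. Silence, however, may also carry information about the chosen expert. The opponent
therefore continues after a silent segment only with the probability that the segment would have
been silent if the other expert had been chosen. A history and its mirror image (experts exchanged
in the current phase) then survive with the same probability, namely the product of the two silence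
probabilities, so no algorithm beats the average of both experts. The difference \<open>D\<close> of the two cumulative
payoffs changes by the full phase length in each phase without messages or coin failures, and coin failures are at
most as likely as messages in the mirrored history.

Following \<open>E (cos (\<theta> D))\<close>, which loses the factor \<open>cos (\<theta> L)\<close> per uninterrupted phase, avoids
anti-concentration estimates: with \<open>\<theta> = 1 / (L \<surd>N)\<close> for \<open>N\<close> phases of length \<open>L\<close>, few messages force
\<open>E \<bar>D\<bar>\<close>, hence the regret, to be of order \<open>L \<surd>N\<close>. As \<open>L\<close> may be a small fraction of \<open>k\<close>, regret below a constant
multiple of \<open>\<surd>(k T)\<close> already forces at least \<open>T / k\<close> messages.
\<close>

section \<open>Expectations over probability mass functions\<close>

lemma integral_bind_pmf_bounded:
  fixes f :: "'b \<Rightarrow> real"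
  assumes "\<And>x y. x \<in> set_pmf p \<Longrightarrow> y \<in> set_pmf (q x) \<Longrightarrow> \<bar>f y\<bar> \<le> K"
  shows "measure_pmf.expectation (p \<bind> q) f =
    measure_pmf.expectation p (\<lambda>x. measure_pmf.expectation (q x) f)"
proof -
  \<comment> \<open>The library rule for \<open>bind\<close> asks for a bound everywhere, while
    \<open>f\<close> is bounded only on the support; \<open>g\<close> truncates it off the
    support.\<close>
  define g where "g y = (if \<bar>f y\<bar> \<le> K then f y else 0)" for y
  have K: "0 \<le> K"
  proof -
    obtain x where "x \<in> set_pmf p" using set_pmf_not_empty by fast
    moreover obtain y where "y \<in> set_pmf (q x)" using set_pmf_not_empty by fast
    ultimately have "\<bar>f y\<bar> \<le> K" by (rule assms)
    then show ?thesis by linarith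
  qed
  have g: "\<bar>g y\<bar> \<le> K" for y using K by (simp add: g_def)
  have "measure_pmf.expectation (p \<bind> q) f = measure_pmf.expectation (p \<bind> q) g"
    using assms by (intro integral_cong_AE) (auto simp: AE_measure_pmf_iff g_def)
  also have "\<dots> = measure_pmf.expectation p (\<lambda>x. measure_pmf.expectation (q x) g)"
    unfolding measure_pmf_bind
    by (rule integral_bind[where K = "count_space UNIV" and B = K and B' = 1])
       (use g in \<open>auto simp: measure_pmf.emeasure_space_1 space_subprob_algebra
          measurable_def intro!: prob_space_imp_subprob_space measure_pmf.prob_space_axioms\<close>)
  also have "\<dots> = measure_pmf.expectation p (\<lambda>x. measure_pmf.expectation (q x) f)"
    using assms by (intro integral_cong_AE AE_pmfI) (auto simp: AE_measure_pmf_iff g_def)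
  finally show ?thesis .
qed

text \<open>On the support, \<open>f\<close> dominates the function that is \<open>u\<close> at
  \<open>x\<close> and \<open>v\<close> elsewhere. The atom will be the silent course of events, and
  \<open>v\<close> the value after some message.\<close>

lemma expectation_ge_atom:
  fixes f :: "'b \<Rightarrow> real"
  assumes "integrable (measure_pmf p) f" "\<And>y. y \<in> set_pmf p \<Longrightarrow> y \<noteq> x \<Longrightarrow> v \<le> f y"
    and "x \<in> set_pmf p \<Longrightarrow> u \<le> f x"
  shows "pmf p x * u + (1 - pmf p x) * v \<le> measure_pmf.expectation p f"
proof -
  have i: "integrable p (\<lambda>y. indicator {x} y * (u - v))"
    by (intro integrable_mult_left) (auto intro!: measure_pmf.integrable_const_bound[where B = 1] AE_pmfI)
  have "measure_pmf.expectation p (\<lambda>y. v + indicator {x} y * (u - v)) = v + pmf p x * (u - v)"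
    using i by (simp add: pmf.rep_eq)
  moreover have "measure_pmf.expectation p (\<lambda>y. v + indicator {x} y * (u - v))
      \<le> measure_pmf.expectation p f"
    using assms i by (intro integral_mono_AE AE_pmfI) (auto simp: indicator_def)
  ultimately show ?thesis by (simp add: algebra_simps)
qed

lemma expectation_ge_const:
  fixes f :: "'b \<Rightarrow> real"
  assumes "integrable (measure_pmf p) f" "\<And>y. y \<in> set_pmf p \<Longrightarrow> v \<le> f y"
  shows "v \<le> measure_pmf.expectation p f"
  using measure_pmf.integral_ge_const[of p f v] assms by (auto simp: AE_measure_pmf_iff)

lemma abs_expectation_le:
  fixes f :: "'b \<Rightarrow> real"
  assumes "\<And>y. y \<in> set_pmf p \<Longrightarrow> \<bar>f y\<bar> \<le> K"
  shows "\<bar>measure_pmf.expectation p f\<bar> \<le> K"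
proof -
  have i: "integrable p f"
    using assms by (intro measure_pmf.integrable_const_bound[where B = K] AE_pmfI) auto
  have "measure_pmf.expectation p f \<le> K"
    using measure_pmf.integral_le_const[OF i, of K] assms by (auto simp: AE_measure_pmf_iff abs_le_iff)
  moreover have "- K \<le> measure_pmf.expectation p f"
    using assms by (intro expectation_ge_const i) (auto simp: abs_le_iff minus_le_iff)
  ultimately show ?thesis by (simp add: abs_le_iff)
qed

section \<open>The shape of histories and deterministic bounds on runs\<close>

lemma picks_simps [simp]:
  "picks [] = []" "picks (h @ g) = picks h @ picks g"
  "picks (Query u # h) = picks h" "picks (Slot u w m # h) = picks h"
  "picks (Pick u a # h) = a # picks h" "picks (Reveal s p # h) = picks h"
  by (simp_all add: picks_def)

lemma payoffs_simps [simp]: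
  "payoffs [] = []" "payoffs (h @ g) = payoffs h @ payoffs g"
  "payoffs (Query u # h) = payoffs h" "payoffs (Slot u w m # h) = payoffs h"
  "payoffs (Pick u a # h) = payoffs h" "payoffs (Reveal s p # h) = p # payoffs h"
  by (simp_all add: payoffs_def)

lemma message_count_simps [simp]:
  "message_count [] = 0" "message_count (h @ g) = message_count h + message_count g"
  "message_count (Query u # h) = message_count h"
  "message_count (Slot u w None # h) = message_count h"
  "message_count (Slot u w (Some x) # h) = Suc (message_count h)"
  "message_count (Pick u a # h) = message_count h"
  "message_count (Reveal s p # h) = message_count h"
  by (simp_all add: message_count_def)

lemma message_count_le_length: "message_count h \<le> length h"
  by (simp add: message_count_def)

lemma length_payoffs_le: "length (payoffs h) \<le> length h"
proof (induction h)
  case (Cons e h)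
  then show ?case by (cases e) auto
qed simp

definition only_slots :: "('n::finite, 'm) history \<Rightarrow> bool" where
  "only_slots g \<longleftrightarrow> (\<forall>e\<in>set g. \<exists>u w m. e = Slot u w m)"

lemma only_slots_simps [simp]:
  "only_slots []" "only_slots (g @ g') \<longleftrightarrow> only_slots g \<and> only_slots g'"
  "only_slots (Slot u w m # g) \<longleftrightarrow> only_slots g"
  by (auto simp: only_slots_def)

lemma only_slots_empty:
  assumes "only_slots g"
  shows "picks g = []" "payoffs g = []"
  using assms by (induction g) (auto simp: only_slots_def)

definition silence :: "(node \<times> node) list \<Rightarrow> ('n::finite, 'm) history" where
  "silence ls = map (\<lambda>(u, w). Slot u w None) ls"

lemma length_silence [simp]: "length (silence ls) = length ls"
  by (simp add: silence_def)

lemma only_slots_silence [simp]: "only_slots (silence ls)"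
  by (auto simp: silence_def only_slots_def)

lemma message_count_silence [simp]: "message_count (silence ls) = 0"
  by (induction ls) (auto simp: silence_def)

text \<open>The links of the slots are fixed in advance, so a stretch without messages is one
  specific list. Silence is therefore a single outcome, and every other outcome contains a
  message.\<close>

lemma run_slots_support:
  assumes "h' \<in> set_pmf (run_slots A ls h)"
  obtains g where "h' = h @ g" "length g = length ls" "only_slots g"
    "g = silence ls \<or> 1 \<le> message_count g"
proof -
  have "\<exists>g. h' = h @ g \<and> length g = length ls \<and> only_slots g \<and> (g = silence ls \<or> 1 \<le> message_count g)"
    using assms
  proof (induction ls arbitrary: h)
    case (Cons l ls)
    obtain u w where l: "l = (u, w)" by force
    from Cons.prems obtain m where "h' \<in> set_pmf (run_slots A ls (h @ [Slot u w m]))"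
      by (auto simp: l)
    from Cons.IH[OF this] obtain g where "h' = h @ [Slot u w m] @ g" "length g = length ls"
      "only_slots g" "g = silence ls \<or> 1 \<le> message_count g"
      by auto
    then show ?case
      by (intro exI[of _ "Slot u w m # g"]) (cases m; auto simp: silence_def l)
  qed (simp add: silence_def)
  then show thesis using that by blast
qed

definition slots :: "('n::finite, 'm) algorithm \<Rightarrow> nat \<Rightarrow> (node \<times> node) list" where
  "slots A k = concat (replicate (sub_rounds A) (links k))"

lemmas communicate_support = run_slots_support[of _ A "slots A k" for A k, folded communicate_def[folded slots_def]]

text \<open>An invariant of all runs. Together with the length of the history it bounds the
  regret.\<close>

definition well_formed :: "('n::finite, 'm) history \<Rightarrow> bool" where
  "well_formed h \<longleftrightarrow> length (picks h) = length (payoffs h) \<and>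
     (\<forall>p\<in>set (payoffs h). \<forall>a. 0 \<le> p $ a \<and> p $ a \<le> 1)"

lemma well_formed_append_slots: "only_slots g \<Longrightarrow> well_formed (h @ g) \<longleftrightarrow> well_formed h"
  by (simp add: well_formed_def only_slots_empty)

lemma play_round_support:
  assumes B: "B \<in> adversaries k" and h': "h' \<in> set_pmf (play_round M A B k h)" and wf: "well_formed h"
  shows "well_formed h'" "length h' = length h + (2 * length (slots A k) + 3)"
    "length (payoffs h') = Suc (length (payoffs h))"
proof -
  \<comment> \<open>How and when the site was chosen is forgotten here, so that both models can be
    treated at once.\<close>
  have "\<exists>u a s p h2 h3. h' = h3 \<and> h2 \<in> set_pmf (communicate A k (h @ [Query u])) \<and>
    p \<in> set_pmf (choose_payoff B h2 s) \<and> h3 \<in> set_pmf (communicate A k (h2 @ [Pick u a, Reveal s p]))"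
    using h' by (cases M) (auto; blast)+
  then obtain u a s p h2 where h2: "h2 \<in> set_pmf (communicate A k (h @ [Query u]))"
    and p: "p \<in> set_pmf (choose_payoff B h2 s)"
    and h3: "h' \<in> set_pmf (communicate A k (h2 @ [Pick u a, Reveal s p]))"
    by blast
  obtain g where g: "h2 = h @ [Query u] @ g" "length g = length (slots A k)" "only_slots g"
    by (rule communicate_support[OF h2]) auto
  obtain g' where g': "h' = h2 @ [Pick u a, Reveal s p] @ g'" "length g' = length (slots A k)" "only_slots g'"
    by (rule communicate_support[OF h3]) auto
  have "\<forall>a. 0 \<le> p $ a \<and> p $ a \<le> 1"
    using B p unfolding adversaries_def by blast
  then show "well_formed h'" "length h' = length h + (2 * length (slots A k) + 3)"
    "length (payoffs h') = Suc (length (payoffs h))"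
    using wf g g' by (auto simp: well_formed_def only_slots_empty)
qed

lemma play_support:
  assumes "B \<in> adversaries k" and "h \<in> set_pmf (play M A B k T)"
  shows "well_formed h \<and> length h = T * (2 * length (slots A k) + 3) \<and> length (payoffs h) = T"
  using assms(2)
proof (induction T arbitrary: h)
  case 0
  then show ?case by (simp add: well_formed_def)
next
  case (Suc T)
  then obtain h0 where "h0 \<in> set_pmf (play M A B k T)" "h \<in> set_pmf (play_round M A B k h0)"
    by auto
  with Suc.IH[of h0] play_round_support[OF assms(1), of h M A h0] show ?case by auto
qed

lemma sum_list_unit_interval:
  assumes "\<And>x. x \<in> set xs \<Longrightarrow> 0 \<le> f x \<and> f x \<le> (1 :: real)"
  shows "0 \<le> sum_list (map f xs)" "sum_list (map f xs) \<le> length xs"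
  using assms by (induction xs) force+

lemma payoff_sums_bounded:
  assumes "well_formed h"
  shows "0 \<le> (\<Sum>p\<leftarrow>payoffs h. p $ a)" "(\<Sum>p\<leftarrow>payoffs h. p $ a) \<le> length (payoffs h)"
    "0 \<le> (\<Sum>(p, a)\<leftarrow>zip (payoffs h) (picks h). p $ a)"
    "(\<Sum>(p, a)\<leftarrow>zip (payoffs h) (picks h). p $ a) \<le> length (payoffs h)"
proof -
  have *: "0 \<le> p $ a \<and> p $ a \<le> 1" if "p \<in> set (payoffs h)" for p a
    using assms that by (auto simp: well_formed_def)
  show "0 \<le> (\<Sum>p\<leftarrow>payoffs h. p $ a)" "(\<Sum>p\<leftarrow>payoffs h. p $ a) \<le> length (payoffs h)"
    using sum_list_unit_interval[of "payoffs h" "\<lambda>p. p $ a"] * by auto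
  have "0 \<le> (case x of (p, a) \<Rightarrow> p $ a) \<and> (case x of (p, a) \<Rightarrow> p $ a) \<le> 1"
    if "x \<in> set (zip (payoffs h) (picks h))" for x
    using that * by (auto split: prod.split dest!: set_zip_leftD)
  from sum_list_unit_interval[of "zip (payoffs h) (picks h)", OF this] assms
  show "0 \<le> (\<Sum>(p, a)\<leftarrow>zip (payoffs h) (picks h). p $ a)"
    "(\<Sum>(p, a)\<leftarrow>zip (payoffs h) (picks h). p $ a) \<le> length (payoffs h)"
    by (auto simp: well_formed_def)
qed

lemma regret_bounded:
  fixes h :: "('n::finite, 'm) history"
  assumes "well_formed h"
  shows "\<bar>regret h\<bar> \<le> length (payoffs h)"
proof -
  have "Max (range (\<lambda>a. \<Sum>p\<leftarrow>payoffs h. p $ a)) \<in> range (\<lambda>a. \<Sum>p\<leftarrow>payoffs h. p $ a)"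
    by (rule Max_in) auto
  then obtain a where "Max (range (\<lambda>a. \<Sum>p\<leftarrow>payoffs h. p $ a)) = (\<Sum>p\<leftarrow>payoffs h. p $ a)"
    by blast
  then show ?thesis
    using payoff_sums_bounded(1,2)[OF assms, of a] payoff_sums_bounded(3,4)[OF assms]
    by (simp add: regret_def)
qed

text \<open>A real supremum dominates its members only over a bounded set; the regret of a run never
  exceeds \<open>T\<close>.\<close>

lemma expectation_regret_le:
  assumes "B \<in> adversaries k"
  shows "measure_pmf.expectation (play M A B k T) regret \<le> expected_regret M k T A"
  unfolding expected_regret_def
proof (rule cSUP_upper[OF assms])
  show "bdd_above ((\<lambda>B. measure_pmf.expectation (play M A B k T) regret) ` adversaries k)"
  proof (rule bdd_aboveI2)
    fix B :: "('a, 'b) adversary" assume B: "B \<in> adversaries k"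
    have "\<bar>measure_pmf.expectation (play M A B k T) regret\<bar> \<le> T"
      by (rule abs_expectation_le) (use play_support[OF B] regret_bounded in blast)
    then show "measure_pmf.expectation (play M A B k T) regret \<le> T" by simp
  qed
qed

lemma expectation_messages_le:
  assumes "B \<in> adversaries k"
  shows "measure_pmf.expectation (play M A B k T) (\<lambda>h. real (message_count h))
    \<le> expected_communication M k T A"
  unfolding expected_communication_def
proof (rule cSUP_upper[OF assms])
  let ?n = "T * (2 * length (slots A k) + 3)"
  show "bdd_above ((\<lambda>B. measure_pmf.expectation (play M A B k T) (\<lambda>h. real (message_count h))) ` adversaries k)"
  proof (rule bdd_aboveI2)
    fix B :: "('a, 'b) adversary" assume B: "B \<in> adversaries k"
    have "\<bar>measure_pmf.expectation (play M A B k T) (\<lambda>h. real (message_count h))\<bar> \<le> real ?n"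
    proof (rule abs_expectation_le)
      fix h assume "h \<in> set_pmf (play M A B k T)"
      from play_support[OF B this] show "\<bar>real (message_count h)\<bar> \<le> real ?n"
        using message_count_le_length[of h] unfolding abs_of_nat of_nat_le_iff by simp
    qed
    then show "measure_pmf.expectation (play M A B k T) (\<lambda>h. real (message_count h)) \<le> real ?n" by simp
  qed
qed

section \<open>Kernels and functions for which all expectations exist\<close>

text \<open>Messages may come from an infinite type, so runs need not have finite support and
  integrability needs a reason: \<open>regular\<close> kernels fix the length of their outcomes, and
  \<open>tame\<close> functions are bounded at each length.\<close>

definition regular :: "(('n::finite, 'm) history \<Rightarrow> ('n, 'm) history pmf) \<Rightarrow> bool" where
  "regular q \<longleftrightarrow> (\<exists>d. \<forall>h. well_formed h \<longrightarrow> (\<forall>h'\<in>set_pmf (q h). well_formed h' \<and> length h' = length h + d))"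

definition tame :: "(('n::finite, 'm) history \<Rightarrow> real) \<Rightarrow> bool" where
  "tame F \<longleftrightarrow> (\<forall>l. \<exists>K. \<forall>h. well_formed h \<longrightarrow> length h = l \<longrightarrow> \<bar>F h\<bar> \<le> K)"

lemma regular_bounded:
  assumes "tame F" "regular q"
  obtains K where "\<And>h h'. well_formed h \<Longrightarrow> length h = l \<Longrightarrow> h' \<in> set_pmf (q h) \<Longrightarrow> \<bar>F h'\<bar> \<le> K"
proof -
  obtain d where d: "\<And>h h'. well_formed h \<Longrightarrow> h' \<in> set_pmf (q h) \<Longrightarrow> well_formed h' \<and> length h' = length h + d"
    using assms(2) unfolding regular_def by blast
  obtain K where "\<And>h. well_formed h \<Longrightarrow> length h = l + d \<Longrightarrow> \<bar>F h\<bar> \<le> K"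
    using assms(1) unfolding tame_def by blast
  with d show thesis by (intro that) blast
qed

lemma regular_integrable:
  assumes "tame F" "regular q" "well_formed h"
  shows "integrable (measure_pmf (q h)) F"
proof -
  obtain K where "\<And>h'. h' \<in> set_pmf (q h) \<Longrightarrow> \<bar>F h'\<bar> \<le> K"
    by (rule regular_bounded[OF assms(1,2), of "length h"]) (use assms(3) in blast)
  then show ?thesis
    by (intro measure_pmf.integrable_const_bound[where B = K] AE_pmfI) auto
qed

lemma tame_expectation:
  assumes "tame F" "regular q"
  shows "tame (\<lambda>h. measure_pmf.expectation (q h) F)"
  unfolding tame_def
proof
  fix l
  obtain K where "\<And>h h'. well_formed h \<Longrightarrow> length h = l \<Longrightarrow> h' \<in> set_pmf (q h) \<Longrightarrow> \<bar>F h'\<bar> \<le> K"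
    by (rule regular_bounded[OF assms]) blast
  then show "\<exists>K. \<forall>h. well_formed h \<longrightarrow> length h = l \<longrightarrow> \<bar>measure_pmf.expectation (q h) F\<bar> \<le> K"
    by (intro exI[of _ K] allI impI abs_expectation_le) blast
qed

lemma regular_bind:
  assumes "regular q" "regular r"
  shows "regular (\<lambda>h. q h \<bind> r)"
proof -
  obtain d where d: "\<And>h h'. well_formed h \<Longrightarrow> h' \<in> set_pmf (q h) \<Longrightarrow> well_formed h' \<and> length h' = length h + d"
    using assms(1) unfolding regular_def by blast
  obtain e where e: "\<And>h h'. well_formed h \<Longrightarrow> h' \<in> set_pmf (r h) \<Longrightarrow> well_formed h' \<and> length h' = length h + e"
    using assms(2) unfolding regular_def by blast
  show ?thesis
    unfolding regular_def set_bind_pmf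
  proof (intro exI[of _ "d + e"] allI impI ballI)
    fix h h' assume "well_formed h" "h' \<in> (\<Union>x\<in>set_pmf (q h). set_pmf (r x))"
    then obtain x where "x \<in> set_pmf (q h)" "h' \<in> set_pmf (r x)" by blast
    with d[of h x] e[of x h'] \<open>well_formed h\<close>
    show "well_formed h' \<and> length h' = length h + (d + e)" by simp
  qed
qed

lemma regular_expectation_bind:
  assumes "tame F" "regular q" "regular r" "well_formed h"
  shows "measure_pmf.expectation (q h \<bind> r) F =
    measure_pmf.expectation (q h) (\<lambda>h'. measure_pmf.expectation (r h') F)"
proof -
  obtain K where "\<And>h'. h' \<in> set_pmf (q h \<bind> r) \<Longrightarrow> \<bar>F h'\<bar> \<le> K"
    by (rule regular_bounded[OF assms(1) regular_bind[OF assms(2,3)], of "length h"]) (use assms(4) in blast)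
  then show ?thesis
    by (intro integral_bind_pmf_bounded[where K = K]) (auto simp: set_bind_pmf)
qed

lemma regular_communicate: "regular (communicate A k)"
  unfolding regular_def
proof (intro exI[of _ "length (slots A k)"] allI impI ballI)
  fix h h' assume wf: "well_formed h" and h': "h' \<in> set_pmf (communicate A k h)"
  obtain g where "h' = h @ g" "length g = length (slots A k)" "only_slots g"
    by (rule communicate_support[OF h'])
  with wf show "well_formed h' \<and> length h' = length h + length (slots A k)"
    by (simp add: well_formed_append_slots)
qed

section \<open>Mirror images of histories\<close>

definition flip :: "real ^ 2 \<Rightarrow> real ^ 2" where
  "flip p = (\<chi> i. if i = 1 then p $ 2 else p $ 1)"

lemma flip_nth [simp]: "flip p $ 1 = p $ 2" "flip p $ 2 = p $ 1"
  by (simp_all add: flip_def)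

lemma vec2_eqI: "p $ 1 = q $ 1 \<Longrightarrow> p $ 2 = q $ 2 \<Longrightarrow> p = (q :: real ^ 2)"
  by (simp add: vec_eq_iff forall_2)

lemma flip_flip [simp]: "flip (flip p) = p"
  by (rule vec2_eqI) simp_all

lemma axis_2_nth [simp]:
  "axis 1 (1::real) $ (1::2) = 1" "axis 1 (1::real) $ (2::2) = 0"
  "axis 2 (1::real) $ (1::2) = 0" "axis 2 (1::real) $ (2::2) = 1"
  by (simp_all add: axis_def)

lemma flip_axis [simp]: "flip (axis 1 1) = axis 2 1" "flip (axis 2 1) = axis 1 1"
  by (rule vec2_eqI; simp; fail)+

lemma flip_unit_interval:
  assumes "\<forall>a. 0 \<le> p $ a \<and> p $ a \<le> 1"
  shows "\<forall>a. 0 \<le> flip p $ a \<and> flip p $ a \<le> 1"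
  using assms by (simp add: forall_2)

fun flip_event :: "(2, 'm) event \<Rightarrow> (2, 'm) event" where
  "flip_event (Reveal s p) = Reveal s (flip p)"
| "flip_event e = e"

lemma flip_event_flip_event [simp]: "flip_event (flip_event e) = e"
  by (cases e) simp_all

lemma map_flip_event_twice [simp]: "map flip_event (map flip_event g) = g"
  by (induction g) simp_all

lemma payoffs_map_flip: "payoffs (map flip_event g) = map flip (payoffs g)"
proof (induction g)
  case (Cons e g)
  then show ?case by (cases e) simp_all
qed simp

lemma picks_map_flip: "picks (map flip_event g) = picks g"
proof (induction g)
  case (Cons e g)
  then show ?case by (cases e) simp_all
qed simp

text \<open>The first \<open>n\<close> payoffs stay, all later ones are swapped. With
  \<open>n\<close> the number of rounds before the current phase, the opponent can compute the
  mirror image from the history alone.\<close>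

fun flip_after :: "nat \<Rightarrow> (2, 'm) history \<Rightarrow> (2, 'm) history" where
  "flip_after 0 h = map flip_event h"
| "flip_after (Suc n) [] = []"
| "flip_after (Suc n) (Reveal s p # h) = Reveal s p # flip_after n h"
| "flip_after (Suc n) (e # h) = e # flip_after (Suc n) h"

lemma map_flip_event_id: "payoffs h = [] \<Longrightarrow> map flip_event h = h"
proof (induction h)
  case (Cons e h)
  then show ?case by (cases e) simp_all
qed simp

text \<open>Whatever follows the \<open>n\<close>-th payoff within \<open>h\<close> contains no
  payoff, so swapping leaves it unchanged.\<close>

lemma flip_after_append:
  "length (payoffs h) = n \<Longrightarrow> flip_after n (h @ g) = h @ map flip_event g"
proof (induction n h rule: flip_after.induct)
  case (1 h)
  then show ?case by (simp add: map_flip_event_id)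
qed simp_all

section \<open>The opponent and the rounds played against it\<close>

text \<open>\<open>L\<close> is the length of a phase and \<open>N\<close> the number of phases;
  \<open>L \<le> k\<close> leaves a fresh site for each round of a phase.\<close>

locale phases =
  fixes M :: prediction_model and A :: "(2, 'm) algorithm" and k L N :: nat
  assumes L_pos: "0 < L" and L_le: "L \<le> k"
begin

definition asked :: "nat \<Rightarrow> node" where
  "asked t = (case M of Site_Prediction \<Rightarrow> Site (t mod L) | Coordinator_Prediction \<Rightarrow> Coordinator)"

definition ask :: "(2, 'm) history \<Rightarrow> (2, 'm) history pmf" where
  "ask h = communicate A k (h @ [Query (asked (length (payoffs h)))])"

text \<open>The random events from a \<open>Reveal\<close> up to the next \<open>Pick\<close>. They
  straddle two rounds, since nodes may react to a payoff both at once and after the next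
  query.\<close>

definition segment :: "(2, 'm) history \<Rightarrow> (2, 'm) history pmf" where
  "segment h = communicate A k h \<bind> ask"

definition quiet :: "nat \<Rightarrow> (2, 'm) history" where
  "quiet t = silence (slots A k) @ [Query (asked t)] @ silence (slots A k)"

text \<open>
\<open>quiet\<close> is everything that happens between a \<open>Reveal\<close> and the following \<open>Pick\<close> if no message is sent, so
\<open>h0\<close> ends with the most recent \<open>Reveal\<close>, and \<open>h'\<close> is its mirror image. After an interruption the last
payoff is 0, which repeats until the end of the phase. Malformed histories do not occur; they are excluded to make
every payoff lie in the unit interval.
\<close>

definition next_payoff :: "(2, 'm) history \<Rightarrow> (real ^ 2) pmf" where
  "next_payoff h =
    (let t = length (payoffs h);
         h0 = take (length h - length (quiet t)) h;
         h' = flip_after (t div L * L) h0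
     in if N * L \<le> t \<or> \<not> well_formed h then return_pmf 0
        else if t mod L = 0 then pmf_of_set {axis 1 1, axis 2 1}
        else if h = h0 @ quiet t
          then map_pmf (\<lambda>c. if c then last (payoffs h) else 0)
            (bernoulli_pmf (pmf (segment h') (h' @ quiet t)))
        else return_pmf 0)"

definition opponent :: "(2, 'm) adversary" where
  "opponent = \<lparr>choose_site = (\<lambda>h. return_pmf (length (payoffs h) mod L)),
     choose_payoff = (\<lambda>h s. next_payoff h)\<rparr>"

lemma next_payoff_support:
  assumes "p \<in> set_pmf (next_payoff h)"
  shows "0 \<le> p $ a \<and> p $ a \<le> 1"
proof -
  have *: "well_formed h \<Longrightarrow> payoffs h \<noteq> [] \<Longrightarrow> 0 \<le> last (payoffs h) $ a \<and> last (payoffs h) $ a \<le> 1"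
    using last_in_set[of "payoffs h"] by (auto simp: well_formed_def)
  \<comment> \<open>A round inside a phase has a predecessor, so \<open>last\<close> is applied to a
    nonempty list.\<close>
  have "t mod L \<noteq> 0 \<Longrightarrow> t \<noteq> 0" for t by (cases t) auto
  with * assms show ?thesis
    by (auto simp: next_payoff_def Let_def axis_def split: if_splits)
qed

lemma opponent_adversary: "opponent \<in> adversaries k"
proof -
  have "t mod L < k" for t using L_pos L_le by (meson less_le_trans mod_less_divisor)
  then show ?thesis
    unfolding adversaries_def opponent_def using next_payoff_support by auto
qed

definition answer :: "(2, 'm) history \<Rightarrow> (2, 'm) history pmf" where
  "answer h = (let t = length (payoffs h) in
     predict A (asked t) (view (asked t) h) \<bind>
     (\<lambda>a. map_pmf (\<lambda>p. h @ [Pick (asked t) a, Reveal (t mod L) p]) (next_payoff h)))"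

text \<open>Whereas \<open>play\<close> adds rounds at the end, these are peeled off at the front,
  which allows induction on the rounds left in a phase.\<close>

fun rounds :: "nat \<Rightarrow> (2, 'm) history \<Rightarrow> (2, 'm) history pmf" where
  "rounds 0 h = return_pmf h"
| "rounds (Suc n) h = ask h \<bind> (\<lambda>h. answer h \<bind> (\<lambda>h. communicate A k h \<bind> rounds n))"

lemma ask_support:
  assumes "h' \<in> set_pmf (ask h)"
  obtains g where "h' = h @ [Query (asked (length (payoffs h)))] @ g" "only_slots g" "length g = length (slots A k)"
    "g = silence (slots A k) \<or> 1 \<le> message_count g"
  using communicate_support[OF assms[unfolded ask_def]] by (metis append_assoc)

lemma answer_support:
  assumes "h' \<in> set_pmf (answer h)"
  obtains u a s p where "h' = h @ [Pick u a, Reveal s p]" "p \<in> set_pmf (next_payoff h)"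
  using assms by (auto simp: answer_def Let_def)

lemma regular_ask: "regular ask"
  unfolding regular_def
proof (intro exI[of _ "Suc (length (slots A k))"] allI impI ballI)
  fix h h' assume wf: "well_formed h" and h': "h' \<in> set_pmf (ask h)"
  from ask_support[OF h'] obtain g where "h' = h @ [Query (asked (length (payoffs h)))] @ g"
    "only_slots g" "length g = length (slots A k)" by metis
  with wf show "well_formed h' \<and> length h' = length h + Suc (length (slots A k))"
    by (simp add: well_formed_def only_slots_empty)
qed

lemma regular_answer: "regular answer"
  unfolding regular_def
proof (intro exI[of _ 2] allI impI ballI)
  fix h h' assume wf: "well_formed h" and h': "h' \<in> set_pmf (answer h)"
  obtain u a s p where "h' = h @ [Pick u a, Reveal s p]" "p \<in> set_pmf (next_payoff h)"
    by (rule answer_support[OF h'])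
  with wf next_payoff_support show "well_formed h' \<and> length h' = length h + 2"
    by (auto simp: well_formed_def)
qed

lemma regular_rounds: "regular (rounds n)"
proof (induction n)
  case 0
  show ?case unfolding regular_def by (rule exI[of _ 0]) simp
next
  case (Suc n)
  have "regular (\<lambda>h. ask h \<bind> (\<lambda>h. answer h \<bind> (\<lambda>h. communicate A k h \<bind> rounds n)))"
    by (intro regular_bind regular_ask regular_answer regular_communicate Suc)
  then show ?case by (simp add: regular_def)
qed

lemma regular_segment: "regular segment"
proof -
  have "regular (\<lambda>h. communicate A k h \<bind> ask)"
    by (intro regular_bind regular_ask regular_communicate)
  then show ?thesis by (simp add: regular_def segment_def)
qed

text \<open>The opponent determines the site from the number of payoffs so far, which communication
  does not change. When it is chosen therefore makes no difference, and the two models differ only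
  in \<open>asked\<close>.\<close>

lemma play_round_opponent:
  "play_round M A opponent k h = ask h \<bind> (\<lambda>h. answer h \<bind> communicate A k)"
proof -
  have len: "length (payoffs h') = length (payoffs h)" if "h' \<in> set_pmf (ask h)" for h'
    by (rule ask_support[OF that]) (simp add: only_slots_empty)
  have *: "play_round M A opponent k h = ask h \<bind> (\<lambda>h'.
      predict A (asked (length (payoffs h))) (view (asked (length (payoffs h))) h') \<bind>
      (\<lambda>a. next_payoff h' \<bind> (\<lambda>p. communicate A k
         (h' @ [Pick (asked (length (payoffs h))) a, Reveal (length (payoffs h) mod L) p]))))"
  proof (cases M)
    case Site_Prediction
    then have "play_round M A B k h = do {
         s \<leftarrow> choose_site B h;
         h' \<leftarrow> communicate A k (h @ [Query (Site s)]);
         a \<leftarrow> predict A (Site s) (view (Site s) h');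
         p \<leftarrow> choose_payoff B h' s;
         communicate A k (h' @ [Pick (Site s) a, Reveal s p])}" for B
      by simp
    moreover have "asked t = Site (t mod L)" for t
      unfolding asked_def by (simp add: Site_Prediction)
    ultimately show ?thesis
      by (simp add: opponent_def bind_return_pmf ask_def)
  next
    case Coordinator_Prediction
    then have "play_round M A B k h = do {
         h' \<leftarrow> communicate A k (h @ [Query Coordinator]);
         a \<leftarrow> predict A Coordinator (view Coordinator h');
         s \<leftarrow> choose_site B h';
         p \<leftarrow> choose_payoff B h' s;
         communicate A k (h' @ [Pick Coordinator a, Reveal s p])}" for B
      by simp
    moreover have as: "asked t = Coordinator" for t
      unfolding asked_def by (simp add: Coordinator_Prediction)
    ultimately show ?thesis
      using len unfolding ask_def as
      by (auto simp: opponent_def bind_return_pmf intro!: bind_pmf_cong)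
  qed
  show ?thesis
    unfolding * by (intro bind_pmf_cong refl)
      (simp add: answer_def Let_def len bind_assoc_pmf map_pmf_def bind_return_pmf)
qed

lemma rounds_snoc:
  "rounds (Suc n) h = rounds n h \<bind> (\<lambda>h. ask h \<bind> (\<lambda>h. answer h \<bind> communicate A k))"
proof (induction n arbitrary: h)
  case 0
  have "rounds 0 = return_pmf" by (rule ext) simp
  then show ?case by (simp add: bind_return_pmf bind_return_pmf')
next
  case (Suc n)
  let ?R = "\<lambda>h. ask h \<bind> (\<lambda>h. answer h \<bind> communicate A k)"
  have eta: "rounds (Suc n) = (\<lambda>h. rounds n h \<bind> ?R)"
    by (rule ext) (rule Suc.IH)
  have "rounds (Suc (Suc n)) h = ask h \<bind> (\<lambda>h. answer h \<bind> (\<lambda>h. communicate A k h \<bind> (\<lambda>h. rounds n h \<bind> ?R)))"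
    unfolding rounds.simps(2)[of "Suc n"] eta ..
  then show ?case by (simp add: bind_assoc_pmf)
qed

lemma play_add: "play M A opponent k (t + n) = play M A opponent k t \<bind> rounds n"
proof (induction n)
  case 0
  have "rounds 0 = return_pmf" by (rule ext) simp
  then show ?case by (simp add: bind_return_pmf')
next
  case (Suc n)
  have "play_round M A opponent k = (\<lambda>h. ask h \<bind> (\<lambda>h. answer h \<bind> communicate A k))"
    by (rule ext) (rule play_round_opponent)
  moreover have "rounds (Suc n) = (\<lambda>h. rounds n h \<bind> (\<lambda>h. ask h \<bind> (\<lambda>h. answer h \<bind> communicate A k)))"
    by (rule ext) (rule rounds_snoc)
  ultimately show ?case
    using Suc by (simp add: bind_assoc_pmf del: rounds.simps)
qed

text \<open>The value of a history that has just ended with a \<open>Reveal\<close> when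
  \<open>n\<close> rounds remain. The cut is placed there because the silence that the opponent
  checks begins at this point.\<close>

definition continuation :: "((2, 'm) history \<Rightarrow> real) \<Rightarrow> nat \<Rightarrow> (2, 'm) history \<Rightarrow> real" where
  "continuation F n h = measure_pmf.expectation (communicate A k h \<bind> rounds n) F"

lemma regular_communicate_rounds: "regular (\<lambda>h. communicate A k h \<bind> rounds n)"
  by (intro regular_bind regular_communicate regular_rounds)

lemma tame_continuation: "tame F \<Longrightarrow> tame (continuation F n)"
  unfolding continuation_def by (intro tame_expectation regular_communicate_rounds)

lemma tame_answer: "tame F \<Longrightarrow> tame (\<lambda>h. measure_pmf.expectation (answer h) (continuation F n))"
  by (intro tame_expectation regular_answer tame_continuation)

lemma expectation_rounds_Suc:
  assumes "tame F" "well_formed h"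
  shows "measure_pmf.expectation (rounds (Suc n) h) F =
    measure_pmf.expectation (ask h) (\<lambda>h. measure_pmf.expectation (answer h) (continuation F n))"
proof -
  have wf: "well_formed h'" if "h' \<in> set_pmf (ask h)" for h'
    using regular_ask assms(2) that unfolding regular_def by blast
  have "measure_pmf.expectation (rounds (Suc n) h) F = measure_pmf.expectation (ask h)
      (\<lambda>h. measure_pmf.expectation (answer h \<bind> (\<lambda>h. communicate A k h \<bind> rounds n)) F)"
    unfolding rounds.simps
    by (intro regular_expectation_bind regular_ask regular_bind regular_answer
        regular_communicate_rounds assms)
  also have "\<dots> = measure_pmf.expectation (ask h)
      (\<lambda>h. measure_pmf.expectation (answer h) (continuation F n))"
    unfolding continuation_def
    by (intro integral_cong_AE AE_pmfI)
      (auto intro!: regular_expectation_bind regular_answer regular_communicate_rounds assms wf)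
  finally show ?thesis .
qed

text \<open>Regroups the run into a whole \<open>segment\<close> followed by an
  \<open>answer\<close>, so that one step contains exactly one decision of the opponent to go
  on.\<close>

lemma continuation_Suc:
  assumes "tame F" "well_formed h"
  shows "continuation F (Suc n) h =
    measure_pmf.expectation (segment h) (\<lambda>h. measure_pmf.expectation (answer h) (continuation F n))"
proof -
  have wf: "well_formed h'" if "h' \<in> set_pmf (communicate A k h)" for h'
    using regular_communicate[of A k] assms(2) that unfolding regular_def by blast
  have "continuation F (Suc n) h = measure_pmf.expectation (communicate A k h)
      (\<lambda>h. measure_pmf.expectation (rounds (Suc n) h) F)"
    unfolding continuation_def
    by (intro regular_expectation_bind regular_communicate regular_rounds assms)
  also have "\<dots> = measure_pmf.expectation (communicate A k h)
      (\<lambda>h. measure_pmf.expectation (ask h) (\<lambda>h. measure_pmf.expectation (answer h) (continuation F n)))"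
    by (intro integral_cong_AE AE_pmfI) (auto simp del: rounds.simps intro!: expectation_rounds_Suc assms wf)
  also have "\<dots> = measure_pmf.expectation (segment h)
      (\<lambda>h. measure_pmf.expectation (answer h) (continuation F n))"
    unfolding segment_def
    by (intro regular_expectation_bind[symmetric] regular_communicate regular_ask tame_answer assms)
  finally show ?thesis .
qed

end

section \<open>Estimates for the cosine\<close>

text \<open>Needed at the end of the game, to pass from \<open>cos (\<theta> * gap h)\<close> to the
  absolute gap.\<close>

lemma one_minus_cos_le: "1 - cos x \<le> \<bar>x :: real\<bar>"
proof -
  have "1 - cos x = 2 * \<bar>sin (x / 2)\<bar>\<^sup>2"
    using cos_double_sin[of "x / 2"] by simp
  also have "\<dots> \<le> 2 * (\<bar>sin (x / 2)\<bar> * 1)"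
    unfolding power2_eq_square by (intro mult_left_mono) auto
  also have "\<dots> \<le> 2 * \<bar>x / 2\<bar>"
    using abs_sin_x_le_abs_x[of "x / 2"] by simp
  finally show ?thesis by simp
qed

text \<open>Gives the decay per phase. The coefficient 1/4 in place of 1/2 absorbs the fourth-order
  Maclaurin term.\<close>

lemma cos_le_quadratic:
  assumes "\<bar>x :: real\<bar> \<le> 1"
  shows "cos x \<le> 1 - x\<^sup>2 / 4"
proof -
  obtain t where "cos x = (\<Sum>m<4. cos_coeff m * x ^ m) + cos (t + 1 / 2 * real 4 * pi) / fact 4 * x ^ 4"
    using Maclaurin_cos_expansion[of x 4] by blast
  then have "cos x = 1 - x\<^sup>2 / 2 + cos (t + 2 * pi) / 24 * x ^ 4"
    by (simp add: cos_coeff_def lessThan_nat_numeral fact_numeral)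
  moreover have "cos (t + 2 * pi) / 24 * x ^ 4 \<le> x ^ 4 / 24"
    using mult_right_mono[OF cos_le_one, of "x ^ 4" "t + 2 * pi"] by simp
  moreover have "x ^ 4 \<le> x\<^sup>2"
    using assms mult_left_le[of "x\<^sup>2" "x\<^sup>2"] by (simp add: abs_square_le_1 flip: power_add)
  moreover have "0 \<le> x\<^sup>2" by simp
  ultimately show ?thesis by linarith
qed

text \<open>Bounds what the cosine can lose when a phase is cut short, and so sets the price of a
  message.\<close>

lemma one_minus_cos_le_quadratic: "1 - cos x \<le> (x :: real)\<^sup>2 / 2"
proof -
  have "1 - cos x = 2 * \<bar>sin (x / 2)\<bar>\<^sup>2"
    using cos_double_sin[of "x / 2"] by simp
  also have "\<bar>sin (x / 2)\<bar>\<^sup>2 \<le> \<bar>x / 2\<bar>\<^sup>2"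
    using abs_sin_x_le_abs_x[of "x / 2"] by (intro power_mono) auto
  finally show ?thesis by (simp add: power_divide)
qed

section \<open>Regret, gap and the potential\<close>

definition gap :: "(2, 'm) history \<Rightarrow> real" where
  "gap h = (\<Sum>p\<leftarrow>payoffs h. p $ 1 - p $ 2)"

text \<open>Regret against the average of the two experts; unlike \<open>regret\<close>, it is
  additive over rounds.\<close>

definition mean_regret :: "(2, 'm) history \<Rightarrow> real" where
  "mean_regret h = (\<Sum>p\<leftarrow>payoffs h. (p $ 1 + p $ 2) / 2) - (\<Sum>(p, a)\<leftarrow>zip (payoffs h) (picks h). p $ a)"

text \<open>The maximum of two numbers is their average plus half their distance.\<close>

lemma regret_eq: "regret h = mean_regret h + \<bar>gap h\<bar> / 2"
proof -
  let ?P = "\<lambda>a. \<Sum>p\<leftarrow>payoffs h. p $ a"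
  have "Max (range ?P) = max (?P 1) (?P 2)"
    unfolding UNIV_2 by simp
  moreover have "gap h = ?P 1 - ?P 2"
    by (simp add: gap_def sum_list_subtractf)
  moreover have "(\<Sum>p\<leftarrow>ps. (p $ 1 + p $ 2) / 2) = ((\<Sum>p\<leftarrow>ps. p $ 1) + (\<Sum>p\<leftarrow>ps. p $ 2)) / 2"
    for ps :: "(real ^ 2) list"
    by (induction ps) (simp_all add: field_simps)
  ultimately show ?thesis
    unfolding regret_def mean_regret_def by (simp add: max_def abs_if field_simps)
qed

lemma gap_append [simp]: "gap (h @ g) = gap h + gap g"
  by (simp add: gap_def)

lemma gap_eq_0: "payoffs g = [] \<Longrightarrow> gap g = 0"
  by (simp add: gap_def)

lemma mean_regret_idle: "payoffs g = [] \<Longrightarrow> picks g = [] \<Longrightarrow> mean_regret (h @ g) = mean_regret h"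
  by (simp add: mean_regret_def)

lemma mean_regret_round:
  assumes "well_formed h"
  shows "mean_regret (h @ [Pick u a, Reveal s p]) = mean_regret h + ((p $ 1 + p $ 2) / 2 - p $ a)"
  using assms by (simp add: mean_regret_def well_formed_def)

lemma mean_regret_bounded:
  assumes "well_formed h"
  shows "\<bar>mean_regret h\<bar> \<le> 2 * length h"
proof -
  have "gap h = (\<Sum>p\<leftarrow>payoffs h. p $ 1) - (\<Sum>p\<leftarrow>payoffs h. p $ 2)"
    by (simp add: gap_def sum_list_subtractf)
  with payoff_sums_bounded(1,2)[OF assms, of 1] payoff_sums_bounded(1,2)[OF assms, of 2]
  have "\<bar>gap h\<bar> \<le> length (payoffs h)" by linarith
  with regret_bounded[OF assms] regret_eq[of h] length_payoffs_le[of h] show ?thesis by linarith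
qed

text \<open>\<open>\<mu>\<close> is the price of a message, and \<open>\<rho>\<close> the factor by
  which the cosine is still to shrink in the phases to come. The invariant will be that the expected
  potential does not fall from phase to phase as \<open>\<rho>\<close> grows to 1.\<close>

definition potential :: "real \<Rightarrow> real \<Rightarrow> real \<Rightarrow> real \<Rightarrow> (2, 'm) history \<Rightarrow> real" where
  "potential c \<theta> \<mu> \<rho> h = c * mean_regret h - \<rho> * cos (\<theta> * gap h) + \<mu> * message_count h"

lemma tame_potential: "tame (potential c \<theta> \<mu> \<rho>)"
  unfolding tame_def
proof (intro allI exI impI)
  fix l and h :: "(2, 'm) history" assume wf: "well_formed h" and l: "length h = l"
  have "\<bar>c * mean_regret h\<bar> \<le> \<bar>c\<bar> * (2 * l)"
    using mean_regret_bounded[OF wf] l by (simp add: abs_mult mult_left_mono)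
  moreover have "\<bar>\<rho> * cos (\<theta> * gap h)\<bar> \<le> \<bar>\<rho>\<bar>"
    by (simp add: abs_mult mult_left_le)
  moreover have "\<bar>\<mu> * message_count h\<bar> \<le> \<bar>\<mu>\<bar> * l"
    using message_count_le_length[of h] l by (simp add: abs_mult mult_left_mono)
  ultimately show "\<bar>potential c \<theta> \<mu> \<rho> h\<bar> \<le> \<bar>c\<bar> * (2 * l) + \<bar>\<rho>\<bar> + \<bar>\<mu>\<bar> * l"
    unfolding potential_def by linarith
qed

lemma potential_idle:
  "payoffs g = [] \<Longrightarrow> picks g = [] \<Longrightarrow>
   potential c \<theta> \<mu> \<rho> (h @ g) = potential c \<theta> \<mu> \<rho> h + \<mu> * message_count g"
  by (simp add: potential_def mean_regret_idle gap_eq_0 algebra_simps)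

lemma potential_zero_round:
  "well_formed h \<Longrightarrow> potential c \<theta> \<mu> \<rho> (h @ [Pick u a, Reveal s 0]) = potential c \<theta> \<mu> \<rho> h"
  by (simp add: potential_def mean_regret_round gap_def)

lemma well_formed_zero_round:
  "well_formed h \<Longrightarrow> well_formed (h @ [Pick u a, Reveal s 0])"
  by (simp add: well_formed_def)

text \<open>Swapping alters only \<open>Reveal\<close> events, and these are seen by their own site
  alone. This is where fresh sites are used.\<close>

lemma view_map_flip_event:
  assumes "\<And>s q. Reveal s q \<in> set g \<Longrightarrow> v \<noteq> Site s"
  shows "view v (map flip_event g) = view v g"
  using assms
proof (induction g)
  case (Cons e g)
  have "view v (map flip_event g) = view v g"
  proof (rule Cons.IH)
    fix s q assume "Reveal s q \<in> set g"
    then show "v \<noteq> Site s" using Cons.prems[of s q] by simp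
  qed
  with Cons.prems show ?case by (cases e) (auto simp: view_def)
qed simp

text \<open>Arithmetic of one step for a history and its twin: \<open>g\<close>, \<open>g'\<close>
  are their silence probabilities, \<open>s\<close>, \<open>s'\<close> their values when the phase
  goes on, \<open>G\<close>, \<open>G'\<close> when it stops. The coin gives both the weight
  \<open>g * g'\<close> of going on, so only the sums \<open>s + s'\<close> and
  \<open>G + G'\<close> matter. Stopping loses at most \<open>(1 - g * g') * \<mu>\<close>, which
  the message payments \<open>(2 - g - g') * \<mu>\<close> cover, the difference being
  \<open>(1 - g) * (1 - g') * \<mu>\<close>.\<close>

lemma coupled_average_bound:
  fixes g g' :: real
  assumes "0 \<le> g" "g \<le> 1" "0 \<le> g'" "g' \<le> 1" and "\<bar>e\<bar> \<le> \<mu>" and "r \<le> s + s'" and "G + G' = r + e"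
  shows "r \<le> (g * (g' * s + (1 - g') * G) + (1 - g) * (G + \<mu>)) +
    (g' * (g * s' + (1 - g) * G') + (1 - g') * (G' + \<mu>))"
proof -
  have "(g * (g' * s + (1 - g') * G) + (1 - g) * (G + \<mu>)) +
      (g' * (g * s' + (1 - g) * G') + (1 - g') * (G' + \<mu>))
    = g * g' * (s + s') + (1 - g * g') * (G + G') + \<mu> * (2 - g - g')"
    by (simp add: algebra_simps)
  also have "\<dots> = r + g * g' * (s + s' - r) + (1 - g * g') * (e + \<mu>) + \<mu> * ((1 - g) * (1 - g'))"
    unfolding assms(7) by (simp add: algebra_simps)
  finally have eq: "(g * (g' * s + (1 - g') * G) + (1 - g) * (G + \<mu>)) +
      (g' * (g * s' + (1 - g) * G') + (1 - g') * (G' + \<mu>)) = \<dots>" .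
  have "0 \<le> g * g' * (s + s' - r)" "0 \<le> (1 - g * g') * (e + \<mu>)" "0 \<le> \<mu> * ((1 - g) * (1 - g'))"
    using assms by (auto intro!: mult_nonneg_nonneg simp: mult_le_one)
  then show ?thesis unfolding eq by linarith
qed

section \<open>The value of one phase\<close>

context phases
begin

text \<open>Ensures that the next \<open>n\<close> payoffs are zero: all phases are over, or the
  current one is interrupted and the \<open>n\<close> rounds do not reach past its end.\<close>

definition finished :: "nat \<Rightarrow> (2, 'm) history \<Rightarrow> bool" where
  "finished n h \<longleftrightarrow> N * L \<le> length (payoffs h) \<or> n = 0 \<or>
     length (payoffs h) mod L \<noteq> 0 \<and> last (payoffs h) = 0 \<and> length (payoffs h) mod L + n \<le> L"

lemma finished_next_payoff:
  assumes "finished (Suc n) h"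
  shows "set_pmf (next_payoff h) \<subseteq> {0}"
  using assms by (auto simp: finished_def next_payoff_def Let_def split: if_splits)

lemma finished_zero_round:
  assumes "finished (Suc n) h \<or> length (payoffs h) mod L + n < L"
  shows "finished n (h @ [Pick u a, Reveal s 0])"
proof (cases "N * L \<le> length (payoffs h) \<or> n = 0")
  case True
  then show ?thesis by (auto simp: finished_def)
next
  case False
  then have "length (payoffs h) mod L + n < L"
    using assms by (auto simp: finished_def)
  \<comment> \<open>Since \<open>n \<noteq> 0\<close>, the next round still lies in the same phase,
    and the index does not wrap around to 0.\<close>
  moreover from this False have "Suc (length (payoffs h)) mod L = Suc (length (payoffs h) mod L)"
    by (simp add: mod_Suc)
  ultimately show ?thesis by (simp add: finished_def)
qed

text \<open>Zero payoffs change neither the gap nor the mean regret, and messages can only raise the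
  potential.\<close>

lemma finished_rounds:
  assumes "0 \<le> \<mu>" "well_formed h" "finished n h" "h' \<in> set_pmf (rounds n h)"
  shows "potential c \<theta> \<mu> \<rho> h \<le> potential c \<theta> \<mu> \<rho> h'"
  using assms(2-4)
proof (induction n arbitrary: h)
  case 0
  then show ?case by simp
next
  case (Suc n)
  from Suc.prems(3) obtain h1 h2 h3 where h1: "h1 \<in> set_pmf (ask h)" and h2: "h2 \<in> set_pmf (answer h1)"
    and h3: "h3 \<in> set_pmf (communicate A k h2)" and h': "h' \<in> set_pmf (rounds n h3)"
    by auto
  obtain g where g: "h1 = h @ [Query (asked (length (payoffs h)))] @ g" "only_slots g"
    by (rule ask_support[OF h1])
  have fin1: "finished (Suc n) h1"
    using Suc.prems(2) g by (simp add: finished_def only_slots_empty)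
  obtain u a s p where "h2 = h1 @ [Pick u a, Reveal s p]" "p \<in> set_pmf (next_payoff h1)"
    by (rule answer_support[OF h2])
  with finished_next_payoff[OF fin1] have h2: "h2 = h1 @ [Pick u a, Reveal s 0]" by auto
  obtain g' where g': "h3 = h2 @ g'" "only_slots g'"
    by (rule communicate_support[OF h3])
  have wf1: "well_formed h1"
    using Suc.prems(1) g by (simp add: well_formed_def only_slots_empty)
  have "finished n h2"
    using finished_zero_round fin1 h2 by blast
  then have "finished n h3"
    using g' by (simp add: finished_def only_slots_empty)
  moreover have "well_formed h3"
    using g' well_formed_zero_round[OF wf1] h2 by (simp add: well_formed_append_slots del: append_assoc)
  ultimately have "potential c \<theta> \<mu> \<rho> h3 \<le> potential c \<theta> \<mu> \<rho> h'"
    using h' by (intro Suc.IH)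
  moreover have "potential c \<theta> \<mu> \<rho> h3 = potential c \<theta> \<mu> \<rho> h1 + \<mu> * message_count g'"
    using g' by (simp add: potential_idle only_slots_empty h2 potential_zero_round[OF wf1] del: append_assoc)
  moreover have "potential c \<theta> \<mu> \<rho> h1 = potential c \<theta> \<mu> \<rho> h + \<mu> * message_count g"
    using g by (simp add: potential_idle only_slots_empty)
  moreover have "0 \<le> \<mu> * message_count g" "0 \<le> \<mu> * message_count g'"
    using assms(1) by simp_all
  ultimately show ?case by linarith
qed

lemma finished_continuation:
  assumes "0 \<le> \<mu>" "well_formed h" "finished n h"
  shows "potential c \<theta> \<mu> \<rho> h \<le> continuation (potential c \<theta> \<mu> \<rho>) n h"
  unfolding continuation_def
proof (rule expectation_ge_const)
  show "integrable (measure_pmf (communicate A k h \<bind> rounds n)) (potential c \<theta> \<mu> \<rho>)"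
    by (intro regular_integrable[where q = "\<lambda>h. communicate A k h \<bind> rounds n"] tame_potential
        regular_communicate_rounds assms)
  fix h' assume "h' \<in> set_pmf (communicate A k h \<bind> rounds n)"
  then obtain h1 where h1: "h1 \<in> set_pmf (communicate A k h)" and h': "h' \<in> set_pmf (rounds n h1)"
    by auto
  obtain g where g: "h1 = h @ g" "only_slots g"
    by (rule communicate_support[OF h1])
  have "potential c \<theta> \<mu> \<rho> h \<le> potential c \<theta> \<mu> \<rho> h1"
    using g assms(1) by (simp add: potential_idle only_slots_empty)
  also have "\<dots> \<le> potential c \<theta> \<mu> \<rho> h'"
    using g assms h' by (intro finished_rounds[where n = n])
      (auto simp: well_formed_append_slots finished_def only_slots_empty)
  finally show "potential c \<theta> \<mu> \<rho> h \<le> potential c \<theta> \<mu> \<rho> h'" .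
qed

lemma zero_round_continuation:
  assumes "0 \<le> \<mu>" "well_formed h" "length (payoffs h) mod L + n < L"
  shows "potential c \<theta> \<mu> \<rho> h \<le> continuation (potential c \<theta> \<mu> \<rho>) n (h @ [Pick u a, Reveal s 0])"
  using finished_continuation[OF assms(1) well_formed_zero_round[OF assms(2)] finished_zero_round, of n]
    potential_zero_round[OF assms(2)] assms(3) by metis

lemma expectation_answer:
  "measure_pmf.expectation (answer h) F =
    (\<Sum>a\<in>UNIV. pmf (predict A (asked (length (payoffs h))) (view (asked (length (payoffs h))) h)) a *
       measure_pmf.expectation (next_payoff h)
         (\<lambda>p. F (h @ [Pick (asked (length (payoffs h))) a, Reveal (length (payoffs h) mod L) p])))"
proof -
  have "finite (set_pmf (next_payoff h))"
    by (auto simp: next_payoff_def Let_def)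
  then show ?thesis
    unfolding answer_def Let_def
    by (subst pmf_expectation_bind[where A = UNIV]) (auto simp: integral_map_pmf)
qed

text \<open>Two runs of a phase that differ only in the expert paid in its first \<open>j\<close>
  rounds; \<open>h0\<close> is their common part before the first pick of the phase. The last clause
  keeps site \<open>j\<close> fresh for the next round.\<close>

definition twins :: "(2, 'm) history \<Rightarrow> nat \<Rightarrow> real ^ 2 \<Rightarrow> (2, 'm) history \<Rightarrow> (2, 'm) history \<Rightarrow> bool" where
  "twins h0 j p h h' \<longleftrightarrow> well_formed h \<and> (\<exists>g. h = h0 @ g \<and> h' = h0 @ map flip_event g \<and>
     payoffs g = replicate j p \<and> (\<forall>s q. Reveal s q \<in> set g \<longrightarrow> s < j))"

lemma twins_sym:
  assumes "twins h0 j p h h'"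
  shows "twins h0 j (flip p) h' h"
proof -
  from assms obtain g where g: "h = h0 @ g" "h' = h0 @ map flip_event g"
    "payoffs g = replicate j p" "\<And>s q. Reveal s q \<in> set g \<Longrightarrow> s < j" and wf: "well_formed h"
    unfolding twins_def by blast
  have "well_formed h'"
    using wf flip_unit_interval unfolding well_formed_def g
    by (auto simp: payoffs_map_flip picks_map_flip)
  moreover have "s < j" if "Reveal s q \<in> set (map flip_event g)" for s q
  proof -
    from that obtain e where e: "e \<in> set g" "Reveal s q = flip_event e" by auto
    from e(2) obtain q' where "e = Reveal s q'" by (cases e) auto
    with e(1) g(4) show ?thesis by blast
  qed
  ultimately show ?thesis
    unfolding twins_def using g by (intro conjI exI[of _ "map flip_event g"]) (auto simp: payoffs_map_flip o_def)
qed

lemma twins_gap: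
  assumes "twins h0 j p h h'"
  shows "gap h = gap h0 + j * (p $ 1 - p $ 2)"
  using assms by (auto simp: twins_def gap_def sum_list_replicate)

lemma quiet_empty [simp]: "payoffs (quiet t) = []" "picks (quiet t) = []" "message_count (quiet t) = 0"
  by (simp_all add: quiet_def only_slots_empty)

lemma twins_extend:
  assumes "twins h0 j p h h'" and p: "\<forall>a. 0 \<le> p $ a \<and> p $ a \<le> 1"
  shows "twins h0 (Suc j) p (h @ quiet t @ [Pick u a, Reveal j p]) (h' @ quiet t @ [Pick u a, Reveal j (flip p)])"
proof -
  from assms(1) obtain g where g: "h = h0 @ g" "h' = h0 @ map flip_event g"
    "payoffs g = replicate j p" "\<And>s q. Reveal s q \<in> set g \<Longrightarrow> s < j" and wf: "well_formed h"
    unfolding twins_def by blast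
  have "Reveal s q \<notin> set (quiet t)" for s q
    by (auto simp: quiet_def silence_def)
  with g(4) have "s < Suc j" if "Reveal s q \<in> set (g @ quiet t @ [Pick u a, Reveal j p])" for s q
    using that by (auto dest: less_SucI)
  moreover have "map flip_event (quiet t) = quiet t"
    by (rule map_flip_event_id) simp
  ultimately show ?thesis
    unfolding twins_def using g wf p
    by (intro conjI exI[of _ "g @ quiet t @ [Pick u a, Reveal j p]"])
      (auto simp: well_formed_def replicate_append_same)
qed

lemma segment_support:
  assumes "h' \<in> set_pmf (segment h)"
  obtains g where "h' = h @ g" "length g = length (quiet (length (payoffs h)))" "payoffs g = []" "picks g = []"
    "g = quiet (length (payoffs h)) \<or> 1 \<le> message_count g"
proof -
  let ?t = "length (payoffs h)"
  from assms obtain h1 where h1: "h1 \<in> set_pmf (communicate A k h)" "h' \<in> set_pmf (ask h1)"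
    unfolding segment_def by auto
  obtain g where g: "h1 = h @ g" "length g = length (slots A k)" "only_slots g"
    "g = silence (slots A k) \<or> 1 \<le> message_count g"
    by (rule communicate_support[OF h1(1)])
  obtain g' where g': "h' = h1 @ [Query (asked (length (payoffs h1)))] @ g'" "only_slots g'"
    "length g' = length (slots A k)" "g' = silence (slots A k) \<or> 1 \<le> message_count g'"
    by (rule ask_support[OF h1(2)])
  show thesis
    by (rule that[of "g @ [Query (asked ?t)] @ g'"])
      (use g g' in \<open>auto simp: quiet_def only_slots_empty\<close>)
qed

text \<open>
The weight \<open>pmf (segment h) \<dots> * pmf (segment h') \<dots>\<close> of going on is symmetric in \<open>h\<close> and its twin \<open>h'\<close>,
and by the freshness of the site so is the distribution of the pick.
\<close>

lemma alive_step:
  fixes c \<theta> \<mu> \<rho> :: real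
  assumes tw: "twins h0 j p h h'" and h0: "length (payoffs h0) = l * L" and l: "l < N"
    and j: "1 \<le> j" "j + Suc n = L" and \<mu>: "0 \<le> \<mu>"
  defines "G \<equiv> potential c \<theta> \<mu> \<rho>" and "t \<equiv> l * L + j"
  shows "pmf (segment h) (h @ quiet t) *
      (pmf (segment h') (h' @ quiet t) * (\<Sum>a\<in>UNIV. pmf (predict A (asked t) (view (asked t) (h @ quiet t))) a *
         continuation G n (h @ quiet t @ [Pick (asked t) a, Reveal j p]))
       + (1 - pmf (segment h') (h' @ quiet t)) * G h)
      + (1 - pmf (segment h) (h @ quiet t)) * (G h + \<mu>) \<le> continuation G (Suc n) h"
proof -
  from tw obtain g where g: "h = h0 @ g" "h' = h0 @ map flip_event g" "payoffs g = replicate j p"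
    and wf: "well_formed h"
    unfolding twins_def by blast
  have t: "length (payoffs h) = t" "t mod L = j" "t div L = l"
    using g h0 j by (auto simp: t_def)
  have "t < Suc l * L" using j by (simp add: t_def)
  also have "\<dots> \<le> N * L" using l by (intro mult_le_mono1) simp
  finally have tN: "t < N * L" .
  have last: "last (payoffs h) = p" using g j by (cases j) auto
  have tame: "tame G" unfolding G_def by (rule tame_potential)
  have zero: "G y \<le> continuation G n (y @ [Pick u a, Reveal s 0])"
    if "well_formed y" "length (payoffs y) = t" for y u a s
    unfolding G_def using that t(2) j by (intro zero_round_continuation \<mu>) auto
  let ?W = "\<lambda>y. measure_pmf.expectation (answer y) (continuation G n)"
  let ?c = "pmf (segment h') (h' @ quiet t)"
  let ?q = "\<lambda>y. predict A (asked t) (view (asked t) y)"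
  show ?thesis
    unfolding continuation_Suc[OF tame wf]
  proof (rule expectation_ge_atom)
    show "integrable (measure_pmf (segment h)) ?W"
      by (intro regular_integrable tame_answer tame regular_segment wf)
  next
    \<comment> \<open>Some message was sent: the opponent stops paying, and the potential has gained
      at least \<open>\<mu>\<close>.\<close>
    fix y assume y: "y \<in> set_pmf (segment h)" "y \<noteq> h @ quiet t"
    obtain g' where g': "y = h @ g'" "length g' = length (quiet t)" "payoffs g' = []" "picks g' = []"
      "g' = quiet t \<or> 1 \<le> message_count g'"
      using segment_support[OF y(1)] t(1) by metis
    have len: "length (payoffs y) = t" using t(1) g' by simp
    have wfy: "well_formed y" using wf g' by (simp add: well_formed_def)
    have "next_payoff y = return_pmf 0"
      using y(2) g' tN j wfy by (simp add: next_payoff_def len t)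
    then have "?W y = (\<Sum>a\<in>UNIV. pmf (?q y) a *
        continuation G n (y @ [Pick (asked t) a, Reveal j 0]))"
      unfolding expectation_answer by (simp add: len t)
    also have "\<dots> \<ge> (\<Sum>a\<in>UNIV. pmf (?q y) a * G y)"
      by (intro sum_mono mult_left_mono zero wfy len) simp
    also have "(\<Sum>a\<in>UNIV. pmf (?q y) a * G y) = G y"
      by (simp add: sum_pmf_eq_1 flip: sum_distrib_right)
    finally have "G y \<le> ?W y" .
    moreover have "G y = G h + \<mu> * message_count g'"
      unfolding G_def g' by (rule potential_idle) (use g' in auto)
    moreover have "\<mu> * 1 \<le> \<mu> * message_count g'"
      using g'(5) y(2) g'(1) \<mu> by (intro mult_left_mono) auto
    ultimately show "G h + \<mu> \<le> ?W y" by simp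
  next
    let ?x = "h @ quiet t"
    have len: "length (payoffs ?x) = t" using t(1) by simp
    have wfx: "well_formed ?x" using wf by (simp add: well_formed_def)
    \<comment> \<open>The mirror image used by the opponent is exactly the twin, so after silence it
      goes on with the silence probability \<open>?c\<close> of the twin.\<close>
    have "flip_after (l * L) h = h'"
      unfolding g by (rule flip_after_append[OF h0])
    then have payoff: "next_payoff ?x = map_pmf (\<lambda>b. if b then p else 0) (bernoulli_pmf ?c)"
      using tN j wfx last by (simp add: next_payoff_def t cong del: if_weak_cong)
    have Gx: "G ?x = G h"
      unfolding G_def by (subst potential_idle) auto
    have "?W ?x = (\<Sum>a\<in>UNIV. pmf (?q ?x) a *
        (?c * continuation G n (?x @ [Pick (asked t) a, Reveal j p]) +
         (1 - ?c) * continuation G n (?x @ [Pick (asked t) a, Reveal j 0])))"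
      unfolding expectation_answer len payoff by (simp add: t pmf_le_1 mult.commute)
    also have "\<dots> \<ge> (\<Sum>a\<in>UNIV. pmf (?q ?x) a *
        (?c * continuation G n (?x @ [Pick (asked t) a, Reveal j p]) + (1 - ?c) * G ?x))"
      by (intro sum_mono mult_left_mono add_left_mono zero wfx len) (simp_all add: pmf_le_1)
    also have "(\<Sum>a\<in>UNIV. pmf (?q ?x) a *
        (?c * continuation G n (?x @ [Pick (asked t) a, Reveal j p]) + (1 - ?c) * G ?x)) =
      ?c * (\<Sum>a\<in>UNIV. pmf (?q ?x) a * continuation G n (?x @ [Pick (asked t) a, Reveal j p])) +
      (1 - ?c) * G h * (\<Sum>a\<in>UNIV. pmf (?q ?x) a)"
      unfolding Gx by (simp add: distrib_left sum.distrib sum_distrib_left mult_ac)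
    finally show "?c * (\<Sum>a\<in>UNIV. pmf (?q ?x) a * continuation G n (h @ quiet t @ [Pick (asked t) a, Reveal j p]))
       + (1 - ?c) * G h \<le> ?W ?x"
      by (simp add: sum_pmf_eq_1)
  qed
qed

text \<open>Induction on the rounds left in the phase. The cosine term is the sum of
  \<open>\<rho> * cos (\<theta> * D)\<close> over the two gaps \<open>D = gap h0 + L\<close> and
  \<open>D = gap h0 - L\<close> of a completed phase; the assumption on \<open>\<mu>\<close> pays
  for phases that stop earlier.\<close>

lemma twins_value:
  fixes c \<theta> \<mu> \<rho> :: real
  assumes h0: "length (payoffs h0) = l * L" "l < N" and \<mu>: "0 \<le> \<mu>" and \<rho>: "0 \<le> \<rho>" "\<rho> \<le> 1"
    and cos: "\<And>j. 1 \<le> j \<Longrightarrow> j < L \<Longrightarrow> 2 * \<bar>cos (\<theta> * j) - cos (\<theta> * L)\<bar> \<le> \<mu>"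
    and tw: "twins h0 j p h h'" "p \<in> {axis 1 1, axis 2 1}" and j: "1 \<le> j" "j + n = L"
  shows "c * (mean_regret h + mean_regret h') + \<mu> * (message_count h + message_count h')
      - 2 * \<rho> * cos (\<theta> * L) * cos (\<theta> * gap h0)
    \<le> continuation (potential c \<theta> \<mu> \<rho>) n h + continuation (potential c \<theta> \<mu> \<rho>) n h'"
  using tw j
proof (induction n arbitrary: j h h')
  note \<theta>_sum = cos_add cos_diff distrib_left right_diff_distrib
  \<comment> \<open>The gaps are \<open>gap h0 + j\<close> and \<open>gap h0 - j\<close>, in an
    order that depends on \<open>p\<close>; the sine terms cancel.\<close>
  have gaps: "cos (\<theta> * gap h) + cos (\<theta> * gap h') = 2 * cos (\<theta> * gap h0) * cos (\<theta> * j)"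
    if "twins h0 j p h h'" for j h h'
    using twins_gap[OF that] twins_gap[OF twins_sym[OF that]] tw(2) by (auto simp: \<theta>_sum)
  have Gsum: "potential c \<theta> \<mu> \<rho> h + potential c \<theta> \<mu> \<rho> h' =
     (c * (mean_regret h + mean_regret h') + \<mu> * (message_count h + message_count h')
      - 2 * \<rho> * cos (\<theta> * L) * cos (\<theta> * gap h0)) + 2 * \<rho> * cos (\<theta> * gap h0) * (cos (\<theta> * L) - cos (\<theta> * j))"
    if "twins h0 j p h h'" for j h h'
  proof -
    have "\<rho> * cos (\<theta> * gap h) + \<rho> * cos (\<theta> * gap h') = \<rho> * (2 * cos (\<theta> * gap h0) * cos (\<theta> * j))"
      unfolding gaps[OF that, symmetric] by (simp add: distrib_left)
    then show ?thesis unfolding potential_def by (simp add: algebra_simps)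
  qed
  {
    case (0 j h h')
    have wf: "well_formed h" "well_formed h'"
      using 0 twins_sym[OF 0(1)] by (auto simp: twins_def)
    have "potential c \<theta> \<mu> \<rho> h \<le> continuation (potential c \<theta> \<mu> \<rho>) 0 h"
      "potential c \<theta> \<mu> \<rho> h' \<le> continuation (potential c \<theta> \<mu> \<rho>) 0 h'"
      by (intro finished_continuation \<mu> wf; simp add: finished_def)+
    with Gsum[OF 0(1)] 0 show ?case by simp
  next
    case (Suc n j h h')
    let ?V = "continuation (potential c \<theta> \<mu> \<rho>)"
    let ?t = "l * L + j"
    let ?R = "c * (mean_regret h + mean_regret h') + \<mu> * (message_count h + message_count h')
      - 2 * \<rho> * cos (\<theta> * L) * cos (\<theta> * gap h0)"
    let ?\<pi> = "pmf (predict A (asked ?t) (view (asked ?t) (h @ quiet ?t)))"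
    let ?e = "\<lambda>h p a. h @ quiet ?t @ [Pick (asked ?t) a, Reveal j p]"
    from Suc.prems(1) obtain g where g: "h = h0 @ g" "h' = h0 @ map flip_event g"
      "\<And>s q. Reveal s q \<in> set g \<Longrightarrow> s < j"
      unfolding twins_def by blast
    have wf: "well_formed h" "well_formed h'"
      using Suc.prems(1) twins_sym[OF Suc.prems(1)] by (auto simp: twins_def)
    \<comment> \<open>The node asked is the coordinator or site \<open>j\<close>, while the payoffs
      of this phase were revealed to sites below \<open>j\<close>. It cannot tell the twins apart
      and draws its pick from the same distribution in both.\<close>
    have "?t mod L = j" using Suc.prems by simp
    then have "view (asked ?t) (map flip_event g) = view (asked ?t) g"
      using g(3) by (intro view_map_flip_event) (auto simp: asked_def split: prediction_model.splits)
    then have view: "view (asked ?t) (h' @ quiet ?t) = view (asked ?t) (h @ quiet ?t)"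
      unfolding g by (simp add: view_def)
    have unit: "\<forall>a. 0 \<le> p $ a \<and> p $ a \<le> 1"
      using tw(2) by (auto simp: axis_def)
    have IH: "?R \<le> ?V n (?e h p a) + ?V n (?e h' (flip p) a)" for a
    proof -
      have wfq: "well_formed (h @ quiet ?t)" "well_formed (h' @ quiet ?t)"
        using wf by (simp_all add: well_formed_def)
      have mr: "mean_regret (?e h p a) = mean_regret h + ((p $ 1 + p $ 2) / 2 - p $ a)" for p
        using mean_regret_round[OF wfq(1), of "asked ?t" a j p] by (simp add: mean_regret_idle)
      have mr': "mean_regret (?e h' p a) = mean_regret h' + ((p $ 1 + p $ 2) / 2 - p $ a)" for p
        using mean_regret_round[OF wfq(2), of "asked ?t" a j p] by (simp add: mean_regret_idle)
      \<comment> \<open>Over both twins, every pick earns as much as the average of the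
        experts.\<close>
      have "p $ a + flip p $ a = p $ 1 + p $ 2"
        using exhaust_2[of a] by auto
      then have "mean_regret (?e h p a) + mean_regret (?e h' (flip p) a) = mean_regret h + mean_regret h'"
        unfolding mr mr' by (simp add: field_simps)
      with Suc.IH[OF twins_extend[OF Suc.prems(1) unit, of ?t "asked ?t" a]] tw(2) Suc.prems
      show ?thesis by simp
    qed
    have "?R = (\<Sum>a\<in>UNIV. ?\<pi> a) * ?R"
      by (simp add: sum_pmf_eq_1)
    also have "\<dots> = (\<Sum>a\<in>UNIV. ?\<pi> a * ?R)"
      by (rule sum_distrib_right)
    also have "\<dots> \<le> (\<Sum>a\<in>UNIV. ?\<pi> a * (?V n (?e h p a) + ?V n (?e h' (flip p) a)))"
      by (intro sum_mono mult_left_mono IH) simp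
    finally have R: "?R \<le> (\<Sum>a\<in>UNIV. ?\<pi> a * ?V n (?e h p a)) + (\<Sum>a\<in>UNIV. ?\<pi> a * ?V n (?e h' (flip p) a))"
      by (simp add: distrib_left sum.distrib)
    \<comment> \<open>Stopping after \<open>j\<close> rounds instead of \<open>L\<close> changes the
      cosine term by at most the price of one message.\<close>
    have "\<bar>2 * \<rho> * cos (\<theta> * gap h0) * (cos (\<theta> * L) - cos (\<theta> * j))\<bar>
        = (\<rho> * \<bar>cos (\<theta> * gap h0)\<bar>) * (2 * \<bar>cos (\<theta> * j) - cos (\<theta> * L)\<bar>)"
      using \<rho> by (simp add: abs_mult abs_minus_commute)
    also have "\<dots> \<le> 1 * \<mu>"
      using \<rho> Suc.prems by (intro mult_mono cos mult_le_one) auto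
    finally have e: "\<bar>2 * \<rho> * cos (\<theta> * gap h0) * (cos (\<theta> * L) - cos (\<theta> * j))\<bar> \<le> \<mu>" by simp
    have "?R \<le> ?V (Suc n) h + ?V (Suc n) h'"
      using coupled_average_bound[OF pmf_nonneg pmf_le_1 pmf_nonneg pmf_le_1 e R Gsum[OF Suc.prems(1)],
          of "segment h" "h @ quiet ?t" "segment h'" "h' @ quiet ?t"]
        alive_step[OF Suc.prems(1) h0 Suc.prems(3,4) \<mu>, of c \<theta> \<rho>]
        alive_step[OF twins_sym[OF Suc.prems(1)] h0 Suc.prems(3,4) \<mu>, of c \<theta> \<rho>]
      unfolding view by linarith
    then show ?case .
  }
qed

text \<open>In the first round the payoff is a fair coin independent of the pick, so the two
  outcomes are twins of equal weight and \<open>twins_value\<close> bounds their average.\<close>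

lemma phase_value:
  fixes c \<theta> \<mu> \<rho> :: real
  assumes h0: "well_formed h0" "length (payoffs h0) = l * L" "l < N"
    and \<mu>: "0 \<le> \<mu>" and \<rho>: "0 \<le> \<rho>" "\<rho> \<le> 1"
    and cos: "\<And>j. 1 \<le> j \<Longrightarrow> j < L \<Longrightarrow> 2 * \<bar>cos (\<theta> * j) - cos (\<theta> * L)\<bar> \<le> \<mu>"
  shows "potential c \<theta> \<mu> (\<rho> * cos (\<theta> * L)) h0
    \<le> measure_pmf.expectation (rounds L h0) (potential c \<theta> \<mu> \<rho>)"
proof -
  let ?v = "potential c \<theta> \<mu> (\<rho> * cos (\<theta> * L)) h0"
  let ?G = "potential c \<theta> \<mu> \<rho> :: (2, 'm) history \<Rightarrow> real"
  obtain n where n: "L = Suc n" using L_pos by (cases L) auto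
  have "?v \<le> measure_pmf.expectation (rounds (Suc n) h0) ?G"
    unfolding expectation_rounds_Suc[OF tame_potential h0(1)]
  proof (rule expectation_ge_const)
    show "integrable (measure_pmf (ask h0)) (\<lambda>h. measure_pmf.expectation (answer h) (continuation ?G n))"
      by (intro regular_integrable tame_answer tame_potential regular_ask h0)
    fix y assume "y \<in> set_pmf (ask h0)"
    then obtain g where "y = h0 @ [Query (asked (length (payoffs h0)))] @ g" "only_slots g"
      by (rule ask_support)
    then obtain g where y: "y = h0 @ g" and g: "payoffs g = []" "picks g = []"
      by (auto simp: only_slots_empty)
    have wf: "well_formed y" using h0 y g by (simp add: well_formed_def)
    have len: "length (payoffs y) = l * L" using h0 y g by simp
    let ?q = "predict A (asked (l * L)) (view (asked (l * L)) y)"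
    let ?e = "\<lambda>a p. y @ [Pick (asked (l * L)) a, Reveal 0 p]"
    let ?e1 = "axis 1 1 :: real ^ 2" and ?e2 = "axis 2 1 :: real ^ 2"
    have "l * L < N * L" using h0(3) L_pos by simp
    then have "next_payoff y = pmf_of_set {?e1, ?e2}"
      using wf by (simp add: next_payoff_def len)
    moreover have "card {?e1, ?e2} = 2"
      by (simp add: axis_eq_axis)
    moreover have "?e1 \<noteq> ?e2" by (simp add: axis_eq_axis)
    ultimately have E: "measure_pmf.expectation (answer y) (continuation ?G n) =
      (\<Sum>a\<in>UNIV. pmf ?q a * ((continuation ?G n (?e a ?e1) + continuation ?G n (?e a ?e2)) / 2))"
      unfolding expectation_answer len by (simp add: integral_pmf_of_set)
    have v: "?v \<le> (continuation ?G n (?e a ?e1) + continuation ?G n (?e a ?e2)) / 2" for a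
    proof -
      have "twins y 1 ?e1 (?e a ?e1) (?e a ?e2)"
        unfolding twins_def using wf
        by (auto simp: well_formed_def forall_2 intro!: exI[of _ "[Pick (asked (l * L)) a, Reveal 0 ?e1]"])
      moreover have "1 + n = L" using n by simp
      ultimately
      have "c * (mean_regret (?e a ?e1) + mean_regret (?e a ?e2)) + \<mu> * (2 * message_count y)
          - 2 * \<rho> * cos (\<theta> * L) * cos (\<theta> * gap y)
        \<le> continuation ?G n (?e a ?e1) + continuation ?G n (?e a ?e2)"
        using twins_value[OF len h0(3) \<mu> \<rho> cos, of 1 ?e1 "?e a ?e1" "?e a ?e2" n c] by simp
      moreover have "mean_regret (?e a ?e1) + mean_regret (?e a ?e2) = 2 * mean_regret y"
        using exhaust_2[of a] by (auto simp: mean_regret_round[OF wf])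
      then have "c * (mean_regret (?e a ?e1) + mean_regret (?e a ?e2)) = 2 * (c * mean_regret y)"
        by simp
      \<comment> \<open>Messages before the first pick do not interrupt the phase, as its coin is
        not yet tossed; they only raise the potential.\<close>
      moreover have "\<mu> * message_count h0 \<le> \<mu> * message_count y"
        using \<mu> y by (intro mult_left_mono) simp_all
      moreover have "mean_regret y = mean_regret h0" "gap y = gap h0"
        using g by (simp_all add: y mean_regret_idle gap_eq_0)
      ultimately show ?thesis by (simp add: potential_def algebra_simps)
    qed
    have "?v = (\<Sum>a\<in>UNIV. pmf ?q a * ?v)"
      by (simp add: sum_pmf_eq_1 flip: sum_distrib_right)
    also have "\<dots> \<le> measure_pmf.expectation (answer y) (continuation ?G n)"
      unfolding E by (intro sum_mono mult_left_mono v) simp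
    finally show "?v \<le> measure_pmf.expectation (answer y) (continuation ?G n)" .
  qed
  then show ?thesis by (simp only: n)
qed

section \<open>Iteration over the phases and the resulting trade-off\<close>

lemma play_eq_rounds: "play M A opponent k n = rounds n []"
  using play_add[of 0 n] by (simp add: bind_return_pmf)

lemma integrable_play: "tame F \<Longrightarrow> integrable (measure_pmf (play M A opponent k n)) F"
  unfolding play_eq_rounds by (intro regular_integrable regular_rounds) (simp_all add: well_formed_def)

text \<open>Each phase uses up one factor \<open>cos (\<theta> * L)\<close> of the weight of the
  cosine. The left-hand side is the potential of the empty history, which carries all
  \<open>N\<close> factors.\<close>

lemma play_potential:
  fixes c \<theta> \<mu> :: real
  assumes \<mu>: "0 \<le> \<mu>" and \<gamma>: "0 \<le> cos (\<theta> * L)"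
    and cos: "\<And>j. 1 \<le> j \<Longrightarrow> j < L \<Longrightarrow> 2 * \<bar>cos (\<theta> * j) - cos (\<theta> * L)\<bar> \<le> \<mu>" and "l \<le> N"
  shows "- (cos (\<theta> * L) ^ N)
    \<le> measure_pmf.expectation (play M A opponent k (l * L)) (potential c \<theta> \<mu> (cos (\<theta> * L) ^ (N - l)))"
  using \<open>l \<le> N\<close>
proof (induction l)
  case 0
  show ?case by (simp add: potential_def mean_regret_def gap_def)
next
  case (Suc l)
  let ?\<gamma> = "cos (\<theta> * L)"
  let ?\<rho> = "?\<gamma> ^ (N - Suc l)"
  let ?G = "potential c \<theta> \<mu> ?\<rho> :: (2, 'm) history \<Rightarrow> real"
  have \<rho>: "0 \<le> ?\<rho>" "?\<rho> \<le> 1" using \<gamma> by (simp_all add: power_le_one)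
  have "?\<rho> * ?\<gamma> = ?\<gamma> ^ (N - l)"
    using Suc.prems by (simp flip: power_Suc2 add: Suc_diff_Suc)
  then have "- (?\<gamma> ^ N) \<le> measure_pmf.expectation (play M A opponent k (l * L)) (potential c \<theta> \<mu> (?\<rho> * ?\<gamma>))"
    using Suc by simp
  also have "\<dots> \<le> measure_pmf.expectation (play M A opponent k (l * L))
      (\<lambda>h. measure_pmf.expectation (rounds L h) ?G)"
  proof (intro integral_mono_AE integrable_play tame_expectation tame_potential regular_rounds AE_pmfI)
    fix h assume "h \<in> set_pmf (play M A opponent k (l * L))"
    from play_support[OF opponent_adversary this] Suc.prems
    show "potential c \<theta> \<mu> (?\<rho> * ?\<gamma>) h \<le> measure_pmf.expectation (rounds L h) ?G"
      by (intro phase_value[of h l] \<mu> \<rho> cos) auto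
  qed
  also have "\<dots> = measure_pmf.expectation (play M A opponent k (l * L) \<bind> rounds L) ?G"
    unfolding play_eq_rounds
    by (intro regular_expectation_bind[symmetric] tame_potential regular_rounds) (simp add: well_formed_def)
  also have "play M A opponent k (l * L) \<bind> rounds L = play M A opponent k (Suc l * L)"
    by (simp add: add.commute flip: play_add)
  finally show ?case .
qed

text \<open>After \<open>N\<close> phases the weight of the cosine is 1, and the remaining rounds
  pay nothing. The weight \<open>2 * \<theta>\<close> of the mean regret is chosen to match
  \<open>\<theta> * \<bar>gap h\<bar>\<close>, the bound for
  \<open>1 - cos (\<theta> * gap h)\<close>: together they form
  \<open>2 * \<theta> * regret h\<close>.\<close>

lemma tradeoff:
  fixes \<theta> \<mu> :: real
  assumes \<mu>: "0 \<le> \<mu>" and \<theta>: "0 < \<theta>" and \<gamma>: "0 \<le> cos (\<theta> * L)"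
    and cos: "\<And>j. 1 \<le> j \<Longrightarrow> j < L \<Longrightarrow> 2 * \<bar>cos (\<theta> * j) - cos (\<theta> * L)\<bar> \<le> \<mu>" and T: "N * L \<le> T"
  shows "1 - cos (\<theta> * L) ^ N
    \<le> 2 * \<theta> * measure_pmf.expectation (play M A opponent k T) regret
      + \<mu> * measure_pmf.expectation (play M A opponent k T) (\<lambda>h. real (message_count h))"
proof -
  let ?P = "\<lambda>n. measure_pmf.expectation (play M A opponent k n)"
  let ?G = "potential (2 * \<theta>) \<theta> \<mu> 1 :: (2, 'm) history \<Rightarrow> real"
  have regret: "tame (regret :: (2, 'm) history \<Rightarrow> real)"
    unfolding tame_def
    using regret_bounded length_payoffs_le by (metis of_nat_mono order_trans)
  have messages: "tame (\<lambda>h :: (2, 'm) history. real (message_count h))"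
    unfolding tame_def using message_count_le_length by (metis abs_of_nat of_nat_mono)
  have "- (cos (\<theta> * L) ^ N) \<le> ?P (N * L) ?G"
    using play_potential[OF \<mu> \<gamma> cos order_refl, of "2 * \<theta>"] by simp
  also have "\<dots> \<le> ?P (N * L) (\<lambda>h. measure_pmf.expectation (rounds (T - N * L) h) ?G)"
  proof (intro integral_mono_AE integrable_play tame_expectation tame_potential regular_rounds AE_pmfI)
    fix h assume "h \<in> set_pmf (play M A opponent k (N * L))"
    from play_support[OF opponent_adversary this]
    have h: "well_formed h" "N * L \<le> length (payoffs h)" by simp_all
    show "?G h \<le> measure_pmf.expectation (rounds (T - N * L) h) ?G"
    proof (rule expectation_ge_const)
      show "integrable (measure_pmf (rounds (T - N * L) h)) ?G"
        by (intro regular_integrable tame_potential regular_rounds h)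
      show "?G h \<le> ?G h'" if "h' \<in> set_pmf (rounds (T - N * L) h)" for h'
        using that h by (intro finished_rounds[OF \<mu>]) (auto simp: finished_def)
    qed
  qed
  also have "\<dots> = measure_pmf.expectation (play M A opponent k (N * L) \<bind> rounds (T - N * L)) ?G"
    unfolding play_eq_rounds
    by (intro regular_expectation_bind[symmetric] tame_potential regular_rounds) (simp add: well_formed_def)
  also have "play M A opponent k (N * L) \<bind> rounds (T - N * L) = play M A opponent k T"
    using T by (simp flip: play_add)
  also have "?P T ?G \<le> ?P T (\<lambda>h. 2 * \<theta> * regret h + \<mu> * message_count h - 1)"
  proof (rule integral_mono)
    show "integrable (measure_pmf (play M A opponent k T)) ?G"
      by (intro integrable_play tame_potential)
    show "integrable (measure_pmf (play M A opponent k T)) (\<lambda>h. 2 * \<theta> * regret h + \<mu> * message_count h - 1)"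
      using integrable_play[OF regret] integrable_play[OF messages] by simp
    fix h :: "(2, 'm) history"
    have "1 - cos (\<theta> * gap h) \<le> \<theta> * \<bar>gap h\<bar>"
      using one_minus_cos_le[of "\<theta> * gap h"] \<theta> by (simp add: abs_mult)
    then show "?G h \<le> 2 * \<theta> * regret h + \<mu> * message_count h - 1"
      unfolding potential_def regret_eq by (simp add: algebra_simps)
  qed
  also have "\<dots> = 2 * \<theta> * ?P T regret + \<mu> * ?P T (\<lambda>h. real (message_count h)) - 1"
    using integrable_play[OF regret] integrable_play[OF messages] by simp
  finally show ?thesis by simp
qed

end

text \<open>For \<open>L = 1\<close> the only pick of a phase precedes every observation made in it: messages do not help.\<close>

lemma regret_communication_tradeoff:
  fixes A :: "(2, 'm) algorithm" and k T L N :: nat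
  assumes "0 < L" "L \<le> k" "0 < N" "N * L \<le> T"
  shows "1 / 5 \<le> 2 / (L * sqrt N) * expected_regret M k T A
    + (if L = 1 then 0 else 1 / N) * expected_communication M k T A"
proof -
  interpret phases M A k L N using assms by unfold_locales
  \<comment> \<open>The angle \<open>\<theta> * L\<close> of a phase, chosen so that
    \<open>N\<close> phases shrink the cosine by a constant factor.\<close>
  define y where "y = 1 / sqrt N"
  have y: "0 < y" "y \<le> 1" "y\<^sup>2 = 1 / N"
    using assms(3) by (auto simp: y_def power_divide)
  define \<theta> where "\<theta> = y / L"
  have \<theta>: "0 < \<theta>" "\<theta> * L = y" "2 * \<theta> = 2 / (L * sqrt N)"
    using y assms(1) by (auto simp: \<theta>_def y_def)
  \<comment> \<open>A phase cut short loses at most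
    \<open>2 * (1 - cos y) \<le> y\<^sup>2 = 1 / N\<close>. For \<open>L = 1\<close> there is no
    \<open>j\<close> with \<open>1 \<le> j < L\<close>, and the price may be 0.\<close>
  define \<mu> where "\<mu> = (if L = 1 then 0 else 1 / N :: real)"
  have \<mu>: "0 \<le> \<mu>" by (simp add: \<mu>_def)
  have "0 \<le> cos y"
    using y pi_ge_two by (intro cos_ge_zero) auto
  have "2 * \<bar>cos (\<theta> * j) - cos (\<theta> * L)\<bar> \<le> \<mu>" if j: "1 \<le> j" "j < L" for j
  proof -
    have "\<theta> * j \<le> \<theta> * L" using j \<theta> by (intro mult_left_mono) auto
    then have "cos (\<theta> * L) \<le> cos (\<theta> * j)"
      using \<theta> y pi_ge_two by (intro cos_monotone_0_pi_le) auto
    then have "2 * \<bar>cos (\<theta> * j) - cos (\<theta> * L)\<bar> = 2 * (cos (\<theta> * j) - cos (\<theta> * L))" by simp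
    also have "\<dots> \<le> 2 * (1 - cos (\<theta> * L))" by simp
    also have "\<dots> \<le> \<mu>"
      using one_minus_cos_le_quadratic[of y] y \<theta> j by (simp add: \<mu>_def)
    finally show ?thesis .
  qed
  then have "1 - cos (\<theta> * L) ^ N
    \<le> 2 * \<theta> * measure_pmf.expectation (play M A opponent k T) regret
      + \<mu> * measure_pmf.expectation (play M A opponent k T) (\<lambda>h. real (message_count h))"
    using \<theta> \<open>0 \<le> cos y\<close> by (intro tradeoff \<mu> assms) auto
  also have "\<dots> \<le> 2 * \<theta> * expected_regret M k T A + \<mu> * expected_communication M k T A"
    using \<theta> \<mu> by (intro add_mono mult_left_mono expectation_regret_le expectation_messages_le opponent_adversary) auto
  finally have main: "1 - cos y ^ N \<le> 2 * \<theta> * expected_regret M k T A + \<mu> * expected_communication M k T A"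
    by (simp add: \<theta>)
  have "cos y ^ N \<le> (1 - y\<^sup>2 / 4) ^ N"
    using y \<open>0 \<le> cos y\<close> by (intro power_mono cos_le_quadratic) auto
  also have "\<dots> = (1 + (- 1 / 4) / N) ^ N"
    by (simp add: y mult.commute)
  also have "\<dots> \<le> exp (- 1 / 4)"
    using assms(3) by (intro exp_ge_one_plus_x_over_n_power_n) auto
  \<comment> \<open>From \<open>exp (1 / 4) \<ge> 5 / 4\<close>.\<close>
  also have "\<dots> \<le> 4 / 5"
    using exp_ge_add_one_self[of "1 / 4"] by (simp add: exp_minus field_simps)
  finally show ?thesis using main unfolding \<theta>(3) \<mu>_def by linarith
qed

section \<open>From the trade-off to the asymptotic bound\<close>

text \<open>Any single adversary is a witness; the opponent with \<open>N = 0\<close> phases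
  serves.\<close>

lemma expected_communication_nonneg:
  fixes A :: "(2, 'm) algorithm"
  assumes "1 \<le> k"
  shows "0 \<le> expected_communication M k T A"
proof -
  interpret phases M A k 1 0 using assms by unfold_locales auto
  have "0 \<le> measure_pmf.expectation (play M A opponent k T) (\<lambda>h. real (message_count h))"
    by simp
  then show ?thesis
    using expectation_messages_le[OF opponent_adversary] by (rule order_trans)
qed

text \<open>Phases of length about \<open>k / 20\<close> are short enough that \<open>T / k\<close>
  messages cover only half of the required 1/5; regret must supply the rest. For
  \<open>k < 20\<close>, phases of length 1 make messages worthless, and the regret assumption is
  contradictory.\<close>

lemma small_regret_needs_communication:
  fixes A :: "(2, 'm) algorithm" and k T :: nat
  assumes k: "1 \<le> k" "k \<le> T" and R: "expected_regret M k T A < sqrt (k * T) / 800"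
  shows "T / k \<le> expected_communication M k T A"
proof (cases "k < 20")
  case True
  have "1 / 5 \<le> 2 / sqrt T * expected_regret M k T A"
    using regret_communication_tradeoff[of 1 k T T M A] k by simp
  then have "sqrt T \<le> 10 * expected_regret M k T A"
    using k by (simp add: field_simps)
  also have "\<dots> < sqrt (k * T) / 80" using R by simp
  also have "sqrt (k * T) \<le> sqrt (80\<^sup>2 * T)"
    unfolding of_nat_mult using True by (intro real_sqrt_le_mono mult_right_mono) auto
  also have "\<dots> = 80 * sqrt T" by (simp add: real_sqrt_mult)
  finally show ?thesis by simp
next
  case False
  define L where "L = k div 20"
  define N where "N = T div L"
  have L: "0 < L" "20 * L \<le> k" "k \<le> 40 * L"
    \<comment> \<open>Rounding down at most halves \<open>k / 20\<close>, because \<open>L\<close>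
      is at least 1.\<close>
    using False unfolding L_def by presburger+
  have "20 * T < 20 * (L * Suc N)"
    using dividend_less_times_div[OF L(1), of T] by (simp add: N_def)
  also have "\<dots> = 20 * L * Suc N" by (simp only: mult.assoc)
  also have "\<dots> \<le> k * Suc N" by (rule mult_le_mono1[OF L(2)])
  \<comment> \<open>Rounding \<open>N\<close> down costs at most \<open>k \<le> T\<close>, which
    leaves \<open>19 * T < k * N\<close>.\<close>
  finally have "10 * T \<le> k * N" using k(2) by simp
  then have N: "10 * (T / k) \<le> N" using k(1) by (simp add: field_simps flip: of_nat_mult of_nat_le_iff)
  have "0 < T / k" using k by simp
  with N have N0: "0 < real N" by linarith
  show ?thesis
  proof (rule ccontr)
    assume "\<not> ?thesis"
    then have C: "expected_communication M k T A \<le> T / k" by simp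
    have "1 / 5 \<le> 2 / (L * sqrt N) * expected_regret M k T A
        + (if L = 1 then 0 else 1 / N) * expected_communication M k T A"
      using L N0 by (intro regret_communication_tradeoff) (auto simp: N_def)
    also have "(if L = 1 then 0 else 1 / N) * expected_communication M k T A \<le> 1 / N * (T / k)"
      using C expected_communication_nonneg[OF k(1), of M T A] by (intro mult_mono) auto
    also have "1 / N * (T / k) = (T / k) / N" by simp
    also have "(T / k) / N \<le> 1 / 10"
      using N by (subst pos_divide_le_eq[OF N0]) (simp add: mult.commute)
    finally have "1 / 10 \<le> 2 / (L * sqrt N) * expected_regret M k T A" by simp
    then have lower: "L * sqrt N \<le> 20 * expected_regret M k T A"
      using L(1) N0 by (simp add: field_simps)
    have "k * T = (real k)\<^sup>2 * (T / k)" using k by (simp add: power2_eq_square)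
    then have "sqrt (k * T) = sqrt ((real k)\<^sup>2) * sqrt (T / k)"
      using real_sqrt_mult[of "(real k)\<^sup>2" "T / k"] by (rule ssubst)
    also have "sqrt ((real k)\<^sup>2) = k" by simp
    also have "k * sqrt (T / k) \<le> (40 * L) * sqrt N"
      using L(3) N \<open>0 < T / k\<close> by (intro mult_mono real_sqrt_le_mono) auto
    finally have "sqrt (k * T) \<le> 40 * (L * sqrt N)" by simp
    \<comment> \<open>The factors 40 and 20 make up the constant 800 of the assumption.\<close>
    with lower R show False by simp
  qed
qed

theorem theorem3:
  fixes M :: prediction_model
    and k T :: "nat \<Rightarrow> nat"
    and A :: "nat \<Rightarrow> (2, 'm) algorithm"
  assumes "\<And>i. 1 \<le> k i" and "\<And>i. k i \<le> T i"
    and "filterlim T at_top sequentially"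
    and "(\<lambda>i. expected_regret M (k i) (T i) (A i)) \<in> o(\<lambda>i. sqrt (real (k i) * real (T i)))"
  shows "\<exists>\<delta>. \<delta> \<in> o(\<lambda>_. 1 :: real) \<and>
    (\<forall>i. expected_communication M (k i) (T i) (A i) \<ge> real (T i) / real (k i) * (1 - \<delta> i))"
proof -
  \<comment> \<open>The bound \<open>T / k\<close> holds exactly once the regret is small enough, so
    the error may be 0 there; the value 1 makes the claim trivial for the other indices.\<close>
  define \<delta> :: "nat \<Rightarrow> real" where
    "\<delta> i = (if real (T i) / real (k i) \<le> expected_communication M (k i) (T i) (A i) then 0 else 1)" for i
  \<comment> \<open>Half of the constant 1/800, to obtain a strict inequality.\<close>
  have "eventually (\<lambda>i. norm (expected_regret M (k i) (T i) (A i))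
      \<le> 1 / 1600 * norm (sqrt (real (k i) * real (T i)))) sequentially"
    using landau_o.smallD[OF assms(4), of "1 / 1600"] by simp
  then have "eventually (\<lambda>i. \<delta> i = 0) sequentially"
  proof eventually_elim
    case (elim i)
    have "0 < sqrt (real (k i) * real (T i))"
      using assms(1,2)[of i] by simp
    moreover have "expected_regret M (k i) (T i) (A i) \<le> 1 / 1600 * sqrt (real (k i) * real (T i))"
      using elim by simp
    ultimately have "expected_regret M (k i) (T i) (A i) < sqrt (real (k i) * real (T i)) / 800"
      by linarith
    then have "real (T i) / real (k i) \<le> expected_communication M (k i) (T i) (A i)"
      using assms(1,2)[of i] by (intro small_regret_needs_communication) simp_all
    then show ?case by (simp add: \<delta>_def)
  qed
  then have "\<delta> \<in> o(\<lambda>_. 1 :: real)"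
    by (subst landau_o.small.in_cong[where g = "\<lambda>_. 0"]) auto
  moreover have "expected_communication M (k i) (T i) (A i) \<ge> real (T i) / real (k i) * (1 - \<delta> i)" for i
    using expected_communication_nonneg[OF assms(1)[of i], of M "T i" "A i"] by (simp add: \<delta>_def)
  ultimately show ?thesis by blast
qed

end
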